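(* Let $n,m$ be positive integers, $\delta_1,\delta_1'\in[0,1)$, $\delta_2,\delta_2'\in[0,\infty)$, and let $C_\delta$ be the Grušin coefficient matrix on $\mathbf{R}^n\times\mathbf{R}^m$ with these parameters. Let $d_\delta$ be the Riemannian distance defined by $C_\delta$ and $B(x_1,x_2;r)$ the ball with centre $(x_1,x_2)$ and radius $r$ with respect to $d_\delta$. Then $$d_\delta(x_1,x_2;y_1,y_2)\sim D_\delta(x_1,x_2;y_1,y_2)$$ uniformly for $(x_1,x_2),(y_1,y_2)\in\mathbf{R}^n\times\mathbf{R}^m$, where $$D_\delta(x_1,x_2;y_1,y_2)=\frac{|x_1-y_1|}{(|x_1|+|y_1|)^{(\delta_1,\delta_1')}}+\Delta_\delta(x_1,x_2;y_1,y_2)$$ and $$\Delta_\delta(x_1,x_2;y_1,y_2)=\begin{cases}|x_2-y_2|/(|x_1|+|y_1|)^{(\delta_2,\delta_2')}&\text{if }|x_2-y_2|\le(|x_1|+|y_1|)^{(\rho,\rho')},\\ |x_2-y_2|^{(1-\gamma,1-\gamma')}&\text{if }|x_2-y_2|\ge(|x_1|+|y_1|)^{(\rho,\rho')},\end{cases}$$ with $\rho=1+\delta_2-\delta_1$, $\rho'=1+\delta_2'-\delta_1'$, $\gamma=\delta_2/\rho$, $\gamma'=\delta_2'/\rho'$. Moreover, the Lebesgue measure of the balls satisfies, uniformly for $(x_1,x_2)\in\mathbf{R}^n\times\mathbf{R}^m$ and $r>0$, $$|B(x_1,x_2;r)|\sim\begin{cases}r^{(D,D')}&\text{if }r\ge|x_1|^{(1-\delta_1,1-\delta_1')},\\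 r^{n+m}\,|x_1|^{(\beta,\beta')}&\text{if }r\le|x_1|^{(1-\delta_1,1-\delta_1')},\end{cases}$$ where $D=(n+m(1+\delta_2-\delta_1))(1-\delta_1)^{-1}$, $D'=(n+m(1+\delta_2'-\delta_1'))(1-\delta_1')^{-1}$, $\beta=n\delta_1+m\delta_2$ and $\beta'=n\delta_1'+m\delta_2'$.
   Context: For $a>0$ and $\alpha,\alpha'\in\mathbf{R}$ set $a^{(\alpha,\alpha')}=a^{\alpha}$ if $a\le1$ and $a^{(\alpha,\alpha')}=a^{\alpha'}$ if $a\ge1$; for $\alpha>0$ put $0^{(\alpha,\alpha')}=0$, and quotients $0/0$ are read as $0$ (this concerns only $x_1=y_1=0$). $f\sim g$ means that there are constants $a,a'>0$ with $af\le g\le a'f$ uniformly in all variables. Coefficients: $c_{\delta_1,\delta_1'},c_{\delta_2,\delta_2'}$ are positive measurable functions on $\mathbf{R}^n$ with $c_{\delta_i,\delta_i'}(x)\sim|x|^{(2\delta_i,2\delta_i')}$, and $C_\delta(x_1,x_2)$ is the block diagonal matrix with blocks $c_{\delta_1,\delta_1'}(x_1)I_n$ and $c_{\delta_2,\delta_2'}(x_1)I_m$. Riemannian distance: $d_\delta(y;z)=\sup\{\psi(y)-\psi(z):\psi\in W^{1,\infty}(\mathbf{R}^n\times\mathbf{R}^m),\ c_{\delta_1,\delta_1'}|\nabla_{x_1}\psi|^2+c_{\delta_2,\delta_2'}|\nabla_{x_2}\psi|^2\le1\text{ a.e.}\}$ (with continuous representatives). The ball is $B(x;r)=\{y:d_\delta(x;y)<r\}$.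 *)

theory Defs
  imports "HOL-Analysis.Analysis"
begin

text \<open>
  \<open>bipow \<alpha> \<alpha>' a\<close> is \<open>a\<^sup>(\<^sup>\<alpha>\<^sup>,\<^sup>\<alpha>\<^sup>')\<close>, used for \<open>a \<ge> 0\<close>. Since \<open>0 powr 0 = 0\<close> in the library, the exponent
  \<open>0\<close> is treated separately, so that \<open>a\<^sup>0 = 1\<close> also for \<open>a = 0\<close>.
\<close>

definition bipow :: "real \<Rightarrow> real \<Rightarrow> real \<Rightarrow> real" where
  "bipow \<alpha> \<alpha>' a =
     (if a \<le> 1 then (if \<alpha> = 0 then 1 else a powr \<alpha>) else a powr \<alpha>')"

text \<open>
  \<open>f \<sim> g\<close> uniformly on \<open>A\<close>. The values are extended reals, so that finiteness of
  distances and volumes is part of the claim.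
\<close>

definition comparable_on :: "'a set \<Rightarrow> ('a \<Rightarrow> ereal) \<Rightarrow> ('a \<Rightarrow> ereal) \<Rightarrow> bool" where
  "comparable_on A f g \<longleftrightarrow>
     (\<exists>a a' :: real. a > 0 \<and> a' > 0 \<and>
        (\<forall>x\<in>A. ereal a * f x \<le> g x \<and> g x \<le> ereal a' * f x))"

text \<open>
  At the origin \<open>|x|\<close> has power \<open>0\<close> if \<open>\<delta> > 0\<close>, which is incompatible with strict positivity of \<open>c\<close>
  there. Positivity and comparability are therefore required off the origin, and the value at
  the origin (a null set) is only required to be nonnegative.
\<close>

definition grusin_coeff :: "real \<Rightarrow> real \<Rightarrow> (real ^ 'n \<Rightarrow> real) \<Rightarrow> bool" where
  "grusin_coeff \<delta> \<delta>' c \<longleftrightarrow>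
     c \<in> borel_measurable lebesgue \<and> c 0 \<ge> 0 \<and> (\<forall>x. x \<noteq> 0 \<longrightarrow> c x > 0) \<and>
     comparable_on (- {0}) (\<lambda>x. ereal (c x)) (\<lambda>x. ereal (bipow (2 * \<delta>) (2 * \<delta>') (norm x)))"

primrec Ck :: "nat \<Rightarrow> ('a::euclidean_space \<Rightarrow> real) \<Rightarrow> bool" where
  "Ck 0 f \<longleftrightarrow> continuous_on UNIV f"
| "Ck (Suc k) f \<longleftrightarrow> (\<forall>x. f differentiable (at x)) \<and>
     (\<forall>b\<in>Basis. Ck k (\<lambda>x. frechet_derivative f (at x) b))"

definition test_function :: "('a::euclidean_space \<Rightarrow> real) \<Rightarrow> bool" where
  "test_function \<phi> \<longleftrightarrow> (\<forall>k. Ck k \<phi>) \<and> compact (closure {x. \<phi> x \<noteq> 0})"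

definition L_infinity :: "('a::euclidean_space \<Rightarrow> 'b::euclidean_space) \<Rightarrow> bool" where
  "L_infinity f \<longleftrightarrow> f \<in> borel_measurable lebesgue \<and> (\<exists>K. AE x in lebesgue. norm (f x) \<le> K)"

text \<open>
  \<open>W1_infinity \<psi> G\<close>: \<open>\<psi>\<close> belongs to \<open>W\<^sup>1\<^sup>,\<^sup>\<infinity>\<close> and \<open>G\<close> is (a version of) its distributional gradient,
  which is unique up to null sets.
\<close>

definition W1_infinity :: "('a::euclidean_space \<Rightarrow> real) \<Rightarrow> ('a \<Rightarrow> 'a) \<Rightarrow> bool" where
  "W1_infinity \<psi> G \<longleftrightarrow> L_infinity \<psi> \<and> L_infinity G \<and>
     (\<forall>\<phi>. test_function \<phi> \<longrightarrow> (\<forall>b\<in>Basis.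
        (\<integral>x. \<psi> x * frechet_derivative \<phi> (at x) b \<partial>lebesgue) = - (\<integral>x. (G x \<bullet> b) * \<phi> x \<partial>lebesgue)))"

text \<open>
  The Riemannian distance; \<open>fst (G x)\<close> and \<open>snd (G x)\<close> are the gradients of \<open>\<psi>\<close> in the variables \<open>x\<^sub>1\<close> and \<open>x\<^sub>2\<close>.
\<close>

definition riem_dist ::
  "(real ^ 'n \<Rightarrow> real) \<Rightarrow> (real ^ 'n \<Rightarrow> real) \<Rightarrow> (real ^ 'n) \<times> (real ^ 'm) \<Rightarrow> (real ^ 'n) \<times> (real ^ 'm) \<Rightarrow> ereal"
  where
  "riem_dist c1 c2 y z =
     Sup {ereal (\<psi> y - \<psi> z) | \<psi>. continuous_on UNIV \<psi> \<and>
        (\<exists>G. W1_infinity \<psi> G \<and>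
           (AE x in lebesgue. c1 (fst x) * (norm (fst (G x)))\<^sup>2 + c2 (fst x) * (norm (snd (G x)))\<^sup>2 \<le> 1))}"

definition riem_ball ::
  "(real ^ 'n \<Rightarrow> real) \<Rightarrow> (real ^ 'n \<Rightarrow> real) \<Rightarrow> (real ^ 'n) \<times> (real ^ 'm) \<Rightarrow> real \<Rightarrow> ((real ^ 'n) \<times> (real ^ 'm)) set"
  where
  "riem_ball c1 c2 x r = {y. riem_dist c1 c2 x y < ereal r}"

text \<open>
  In the two case distinctions below both formulas agree when the compared quantities are equal.
  The library convention \<open>t / 0 = 0\<close> is only used as \<open>0 / 0 = 0\<close>, for \<open>x\<^sub>1 = y\<^sub>1 = 0\<close>.
\<close>

definition Delta_fun ::
  "real \<Rightarrow> real \<Rightarrow> real \<Rightarrow> real \<Rightarrow> (real ^ 'n) \<times> (real ^ 'm) \<Rightarrow> (real ^ 'n) \<times> (real ^ 'm) \<Rightarrow> real" where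
  "Delta_fun \<delta>1 \<delta>1' \<delta>2 \<delta>2' x y =
     (let \<rho> = 1 + \<delta>2 - \<delta>1; \<rho>' = 1 + \<delta>2' - \<delta>1';
          \<gamma> = \<delta>2 / \<rho>; \<gamma>' = \<delta>2' / \<rho>';
          s = norm (fst x) + norm (fst y);
          t = norm (snd x - snd y)
      in if t \<le> bipow \<rho> \<rho>' s then t / bipow \<delta>2 \<delta>2' s else bipow (1 - \<gamma>) (1 - \<gamma>') t)"

definition D_fun ::
  "real \<Rightarrow> real \<Rightarrow> real \<Rightarrow> real \<Rightarrow> (real ^ 'n) \<times> (real ^ 'm) \<Rightarrow> (real ^ 'n) \<times> (real ^ 'm) \<Rightarrow> real" where
  "D_fun \<delta>1 \<delta>1' \<delta>2 \<delta>2' x y =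
     norm (fst x - fst y) / bipow \<delta>1 \<delta>1' (norm (fst x) + norm (fst y)) + Delta_fun \<delta>1 \<delta>1' \<delta>2 \<delta>2' x y"

definition volume_fun ::
  "real \<Rightarrow> real \<Rightarrow> real \<Rightarrow> real \<Rightarrow> (real ^ 'n) \<times> (real ^ 'm) \<Rightarrow> real \<Rightarrow> real" where
  "volume_fun \<delta>1 \<delta>1' \<delta>2 \<delta>2' x r =
     (let n = CARD('n); m = CARD('m);
          D = (real n + real m * (1 + \<delta>2 - \<delta>1)) / (1 - \<delta>1);
          D' = (real n + real m * (1 + \<delta>2' - \<delta>1')) / (1 - \<delta>1');
          \<beta> = real n * \<delta>1 + real m * \<delta>2;
          \<beta>' = real n * \<delta>1' + real m * \<delta>2'
      in if r \<ge> bipow (1 - \<delta>1) (1 - \<delta>1') (norm (fst x)) then bipow D D' r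
         else r ^ (n + m) * bipow \<beta> \<beta>' (norm (fst x)))"

end

(*
  The gradient constraint bounds |grad_1 psi| by a multiple of |x_1|^(-delta_1) and |grad_2 psi| by a
  multiple of |x_1|^(-delta_2).  Since these weights blow up only at x_1 = 0, the lower bound for the
  distance needs just one truncated quadratic bump, supported in the set where |x_1| is at most
  twice the relevant scale.  For the upper bound, psi is mollified along segments on which |x_1| is
  essentially constant, and a dyadic chain of such segments joins x_1 to 0; a large displacement in x_2
  is made at the height |x_1| = R where R^rho = |x_2 - y_2|.  Hence a ball of radius r is comparable to
  a product of Euclidean balls of radii r R^delta_1 and r R^delta_2, where R is the maximum of |x_1| and
  r^(1/(1-delta_1)).
*)

theory Submission imports Defs
begin

section \<open>Two-regime powers\<close>

text \<open>The distance is a supremum over functions that only have a distributional gradient, so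
  there are no curves whose length could be estimated. An inequality for \<psi> along a segment has
  to come from a gradient bound valid almost everywhere in a tube around the segment; this is why
  smooth bumps are needed, and the continuity of \<psi> recovers the values at the endpoints. Where
  the weights degenerate, near x_1 = 0, the constraint gives no uniform bound on the gradient, and
  for n = 1 this set even separates the space. It is therefore reached only as a limit, and the cost
  of the halving steps sums to a finite amount because \<delta>1, \<delta>1' < 1. The case
  distinctions in the statement are removed at once: \<Delta> equals
  \<open>t / b2 (max s (Pinv t))\<close> with s = |x_1| + |y_1| and t = |x_2 - y_2|, and the volume
  function is a product of powers of \<open>rad1\<close> and \<open>rad2\<close>. The estimates then
  rest on monotonicity and scaling of the weights, so that the local and the global exponents need
  not be treated separately.\<close>

lemma bipow_eq: "a > 0 \<Longrightarrow> bipow \<alpha> \<alpha>' a = a powr (if a \<le> 1 then \<alpha> else \<alpha>')"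
  by (auto simp: bipow_def)

lemma bipow_pos: "a > 0 \<Longrightarrow> bipow \<alpha> \<alpha>' a > 0"
  by (simp add: bipow_eq)

lemma bipow_nonneg: "bipow \<alpha> \<alpha>' a \<ge> 0"
  by (simp add: bipow_def)

lemma bipow_zero: "\<alpha> \<noteq> 0 \<Longrightarrow> bipow \<alpha> \<alpha>' 0 = 0"
  by (simp add: bipow_def)

lemma bipow_one: "a > 0 \<Longrightarrow> bipow 1 1 a = a"
  by (simp add: bipow_eq)

lemma bipow_mult: "a > 0 \<Longrightarrow> bipow \<alpha> \<alpha>' a * bipow \<beta> \<beta>' a = bipow (\<alpha> + \<beta>) (\<alpha>' + \<beta>') a"
  by (simp add: bipow_eq powr_add)

lemma bipow_divide: "a > 0 \<Longrightarrow> bipow \<alpha> \<alpha>' a / bipow \<beta> \<beta>' a = bipow (\<alpha> - \<beta>) (\<alpha>' - \<beta>') a"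
  by (simp add: bipow_eq powr_diff)

lemma bipow_power: "a > 0 \<Longrightarrow> bipow \<alpha> \<alpha>' a ^ k = bipow (real k * \<alpha>) (real k * \<alpha>') a"
  by (simp add: bipow_eq powr_power mult.commute)

text \<open>With non-negative inner exponents the inner power stays on the same side of 1 as
  \<open>a\<close>, so the outer power picks the matching branch and the exponents multiply.\<close>

lemma bipow_comp:
  assumes "a > 0" "\<beta> \<ge> 0" "\<beta>' \<ge> 0"
  shows "bipow \<alpha> \<alpha>' (bipow \<beta> \<beta>' a) = bipow (\<beta> * \<alpha>) (\<beta>' * \<alpha>') a"
proof (cases "a \<le> 1")
  case True
  with assms have "a powr \<beta> \<le> 1" by (simp add: powr_le1)
  with True assms show ?thesis by (simp add: bipow_eq powr_powr)
next
  case False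
  with assms have "a powr \<beta>' \<ge> 1" by (simp add: ge_one_powr_ge_zero)
  \<comment> \<open>For \<open>\<beta>' = 0\<close> the inner value is exactly 1, which belongs to
    the branch of \<open>\<alpha>\<close>; both sides are then 1.\<close>
  then have "a powr \<beta>' = 1 \<or> \<not> a powr \<beta>' \<le> 1" by auto
  moreover have "a powr (\<beta>' * \<alpha>') = 1" if "a powr \<beta>' = 1"
    using that by (metis powr_one_eq_one powr_powr)
  ultimately show ?thesis using False assms by (auto simp: bipow_eq powr_powr)
qed

text \<open>Both branches have the value 1 at 1, so arguments on opposite sides of 1 are compared
  through 1.\<close>

lemma bipow_mono:
  assumes "0 \<le> \<alpha>" "0 \<le> \<alpha>'" "0 \<le> a" "a \<le> b"
  shows "bipow \<alpha> \<alpha>' a \<le> bipow \<alpha> \<alpha>' b"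
proof -
  have *: "1 \<le> b powr \<alpha>'" if "b > 1"
    using that assms by (simp add: ge_one_powr_ge_zero)
  have **: "a powr \<alpha> \<le> 1" if "a \<le> 1"
    using that assms by (simp add: powr_le1)
  show ?thesis
    using assms * ** by (auto simp: bipow_def intro: powr_mono2 order_trans[of _ 1])
qed

lemma bipow_strict_mono:
  assumes "0 < \<alpha>" "0 < \<alpha>'" "0 \<le> a" "a < b"
  shows "bipow \<alpha> \<alpha>' a < bipow \<alpha> \<alpha>' b"
proof -
  have *: "1 < b powr \<alpha>'" if "b > 1"
    using that assms by simp
  have **: "a powr \<alpha> \<le> 1" if "a \<le> 1"
    using that assms by (simp add: powr_le1)
  show ?thesis
    using assms * ** by (auto simp: bipow_def intro: powr_less_mono2 order_le_less_trans[of _ 1])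
qed

lemma bipow_le_iff:
  assumes "0 < \<alpha>" "0 < \<alpha>'" "0 \<le> a" "0 \<le> b"
  shows "bipow \<alpha> \<alpha>' a \<le> bipow \<alpha> \<alpha>' b \<longleftrightarrow> a \<le> b"
  using bipow_strict_mono[OF assms(1,2)] bipow_mono[of \<alpha> \<alpha>'] assms
  by (meson less_eq_real_def not_le)

text \<open>Only the case where scaling by \<open>l\<close> crosses 1 goes beyond homogeneity.
  Raising an exponent increases powers of numbers above 1 and decreases powers of numbers below 1,
  so the larger exponent can be inserted for \<open>l * a\<close> and removed again for
  \<open>a\<close>. This is the doubling property behind \<open>L\<close> and
  \<open>rad_scale\<close>.\<close>

lemma bipow_scale_upper:
  assumes "l \<ge> 1" "a > 0"
  shows "bipow \<alpha> \<alpha>' (l * a) \<le> l powr max \<alpha> \<alpha>' * bipow \<alpha> \<alpha>' a"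
proof -
  let ?M = "max \<alpha> \<alpha>'"
  have la: "l * a > 0" "l * a \<ge> a" using assms by auto
  consider "l * a \<le> 1" | "a \<le> 1" "l * a > 1" | "a > 1" by linarith
  then show ?thesis
  proof cases
    case 2
    have "(l * a) powr \<alpha>' \<le> (l * a) powr ?M" using 2 by (intro powr_mono) auto
    also have "\<dots> = l powr ?M * a powr ?M" using assms by (simp add: powr_mult)
    also have "\<dots> \<le> l powr ?M * a powr \<alpha>"
      using 2 assms by (intro mult_left_mono powr_mono') auto
    finally show ?thesis using 2 assms by (simp add: bipow_eq)
  next
    case 1
    with la have "a \<le> 1" by linarith
    with 1 assms show ?thesis by (auto simp: bipow_eq powr_mult intro!: mult_right_mono powr_mono)
  next
    case 3
    with la have "\<not> l * a \<le> 1" by linarith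
    with 3 assms show ?thesis by (auto simp: bipow_eq powr_mult intro!: mult_right_mono powr_mono)
  qed
qed

text \<open>Same argument with the smaller exponent. Applied to the exponents 1 - \<delta>1 and 1 -
  \<delta>1' it gives geometric decay of \<open>N\<close> under halving.\<close>

lemma bipow_scale_lower:
  assumes "l \<ge> 1" "a > 0"
  shows "l powr min \<alpha> \<alpha>' * bipow \<alpha> \<alpha>' a \<le> bipow \<alpha> \<alpha>' (l * a)"
proof -
  let ?M = "min \<alpha> \<alpha>'"
  have la: "l * a > 0" "l * a \<ge> a" using assms by auto
  consider "l * a \<le> 1" | "a \<le> 1" "l * a > 1" | "a > 1" by linarith
  then show ?thesis
  proof cases
    case 2
    have "l powr ?M * a powr \<alpha> \<le> l powr ?M * a powr ?M"
      using 2 assms by (intro mult_left_mono powr_mono') auto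
    also have "\<dots> = (l * a) powr ?M" using assms by (simp add: powr_mult)
    also have "\<dots> \<le> (l * a) powr \<alpha>'" using 2 by (intro powr_mono) auto
    finally show ?thesis using 2 assms by (simp add: bipow_eq)
  next
    case 1
    with la have "a \<le> 1" by linarith
    with 1 assms show ?thesis by (auto simp: bipow_eq powr_mult intro!: mult_right_mono powr_mono)
  next
    case 3
    with la have "\<not> l * a \<le> 1" by linarith
    with 3 assms show ?thesis by (auto simp: bipow_eq powr_mult intro!: mult_right_mono powr_mono)
  qed
qed

section \<open>Distributional gradients of $C^1$ functions\<close>

lemma integrable_bounded_times:
  fixes u \<phi> :: "'a::euclidean_space \<Rightarrow> real"
  assumes u: "u \<in> borel_measurable lebesgue" "AE x in lebesgue. \<bar>u x\<bar> \<le> K"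
    and \<phi>: "continuous_on UNIV \<phi>" and supp: "\<And>x. norm x > r \<Longrightarrow> \<phi> x = 0"
  shows "integrable lebesgue (\<lambda>x. u x * \<phi> x)"
proof -
  have "compact (\<phi> ` cball 0 r)"
    by (intro compact_continuous_image continuous_on_subset[OF \<phi>]) auto
  then obtain C where C: "\<And>x. x \<in> cball 0 r \<Longrightarrow> norm (\<phi> x) \<le> C"
    unfolding image_iff by (metis bounded_iff compact_imp_bounded imageI)
  have "\<phi> \<in> borel_measurable borel" using \<phi> by (simp add: borel_measurable_continuous_onI)
  then have m: "\<phi> \<in> borel_measurable lebesgue" by (simp add: measurable_completion)
  have i: "integrable lebesgue (\<lambda>x. \<bar>K\<bar> * \<bar>C\<bar> * indicator (cball 0 r :: 'a set) x :: real)"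
    by (intro integrable_mult_right) (auto simp: integrable_indicator_iff emeasure_lborel_cball_finite[unfolded infinity_ennreal_def])
  show ?thesis
  proof (rule Bochner_Integration.integrable_bound[OF i])
    show "(\<lambda>x. u x * \<phi> x) \<in> borel_measurable lebesgue" using u m by simp
    show "AE x in lebesgue. norm (u x * \<phi> x) \<le> norm (\<bar>K\<bar> * \<bar>C\<bar> * indicator (cball 0 r) x :: real)"
      using u(2)
    proof eventually_elim
      case (elim x)
      show ?case
      proof (cases "x \<in> cball 0 r")
        case True
        then have "\<bar>\<phi> x\<bar> \<le> \<bar>C\<bar>" using C[OF True] by auto
        moreover have "\<bar>u x\<bar> \<le> \<bar>K\<bar>" using elim by auto
        ultimately show ?thesis using True by (simp add: abs_mult mult_mono)
      qed (use supp[of x] in auto)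
    qed
  qed
qed

lemma has_derivative_outside_support:
  fixes F :: "'a::real_normed_vector \<Rightarrow> 'b::real_normed_vector"
  assumes "(F has_derivative F') (at x)" and supp: "\<And>y. norm y > r \<Longrightarrow> F y = 0" and x: "norm x > r"
  shows "F' = (\<lambda>h. 0)"
proof -
  have "((\<lambda>y. 0) has_derivative F') (at x)"
    using x supp
    by (intro has_derivative_transform_within_open[OF assms(1), of "- cball 0 r"]) auto
  then show ?thesis by (intro has_derivative_unique[of "\<lambda>y. 0" F' x]) auto
qed

lemma linear_eq_sum_Basis:
  fixes f :: "'a::euclidean_space \<Rightarrow> real"
  assumes "linear f"
  shows "f v = (\<Sum>b\<in>Basis. (v \<bullet> b) * f b)"
proof -
  have "f v = f (\<Sum>b\<in>Basis. (v \<bullet> b) *\<^sub>R b)" by (simp add: euclidean_representation)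
  also have "\<dots> = (\<Sum>b\<in>Basis. (v \<bullet> b) * f b)"
    by (simp add: linear_sum[OF assms] linear_scale[OF assms])
  finally show ?thesis .
qed

text \<open>Dominated convergence: the mean value inequality bounds the difference quotients
  uniformly. The factor \<open>u\<close> is merely bounded and measurable; \<open>u = 1\<close>
  yields that derivatives integrate to zero, and \<open>u = \<psi>\<close> differentiates a
  mollification.\<close>

lemma difference_quotient_integral:
  fixes F u :: "'a::euclidean_space \<Rightarrow> real" and v :: 'a
  assumes deriv: "\<And>x. (F has_derivative F' x) (at x)"
    and cont: "continuous_on UNIV (\<lambda>x. F' x v)"
    and supp: "\<And>x. norm x > r \<Longrightarrow> F x = 0"
    and u: "u \<in> borel_measurable lebesgue" "AE x in lebesgue. \<bar>u x\<bar> \<le> K"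
  shows "((\<lambda>h. \<integral>x. u x * ((F (x + h *\<^sub>R v) - F x) / h) \<partial>lebesgue)
            \<longlongrightarrow> (\<integral>x. u x * F' x v \<partial>lebesgue)) (at 0)"
proof -
  have F'0: "F' x v = 0" if "norm x > r" for x
    using has_derivative_outside_support[OF deriv supp that] by simp
  have "compact ((\<lambda>x. F' x v) ` cball 0 r)"
    by (intro compact_continuous_image continuous_on_subset[OF cont]) auto
  then obtain C where C: "\<And>x. x \<in> cball 0 r \<Longrightarrow> norm (F' x v) \<le> C"
    unfolding image_iff by (metis bounded_iff compact_imp_bounded imageI)
  have C': "\<bar>F' x v\<bar> \<le> \<bar>C\<bar>" for x
    using C[of x] F'0[of x] by (cases "norm x \<le> r") auto
  have Fcont: "continuous_on UNIV F"
    using deriv by (meson continuous_at_imp_continuous_on has_derivative_continuous)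
  have along: "((\<lambda>t. F (x + t *\<^sub>R v)) has_field_derivative F' (x + t *\<^sub>R v) v) (at t)" for x t
  proof -
    have "((\<lambda>t. F (x + t *\<^sub>R v)) has_derivative (\<lambda>s. F' (x + t *\<^sub>R v) (s *\<^sub>R v))) (at t)"
      by (rule has_derivative_compose[where g = F, OF _ deriv]) (auto intro!: derivative_eq_intros)
    moreover have "F' (x + t *\<^sub>R v) (s *\<^sub>R v) = F' (x + t *\<^sub>R v) v * s" for s
      using linear_scale[OF has_derivative_linear[OF deriv]] by simp
    ultimately show ?thesis by (simp add: has_field_derivative_def)
  qed
  have diff: "\<bar>F (x + h *\<^sub>R v) - F x\<bar> \<le> \<bar>C\<bar> * \<bar>h\<bar>" for x h
  proof -
    have "norm (F (x + h *\<^sub>R v) - F (x + 0 *\<^sub>R v)) \<le> \<bar>C\<bar> * norm (h - 0)"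
      using C' along by (intro field_differentiable_bound[where S = UNIV and f' = "\<lambda>t. F' (x + t *\<^sub>R v) v"])
        auto
    then show ?thesis by simp
  qed
  have lim: "((\<lambda>h. (F (x + h *\<^sub>R v) - F x) / h) \<longlongrightarrow> F' x v) (at 0)" for x
    using along[of x 0] by (simp add: has_field_derivative_iff)
  \<comment> \<open>For \<open>\<bar>h\<bar> \<le> 1\<close> the shifted function vanishes outside
    the ball of radius \<open>r + norm v\<close>, so one dominating function serves the tail of any
    null sequence.\<close>
  define w where "w = (\<lambda>x::'a. \<bar>K\<bar> * \<bar>C\<bar> * indicator (cball 0 (r + norm v)) x :: real)"
  have i: "integrable lebesgue w" unfolding w_def
    by (intro integrable_mult_right) (auto simp: integrable_indicator_iff emeasure_lborel_cball_finite[unfolded infinity_ennreal_def])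
  have "continuous_on UNIV (\<lambda>x. F (x + a))" for a
    by (intro continuous_on_compose2[OF Fcont] continuous_intros) auto
  then have mF: "(\<lambda>x. F (x + a)) \<in> borel_measurable lebesgue" for a
    by (intro measurable_completion) (simp add: borel_measurable_continuous_onI)
  have mF': "(\<lambda>x. F' x v) \<in> borel_measurable lebesgue"
    by (intro measurable_completion) (use cont in \<open>simp add: borel_measurable_continuous_onI\<close>)
  have "(\<lambda>n. \<integral>x. u x * ((F (x + X n *\<^sub>R v) - F x) / X n) \<partial>lebesgue)
          \<longlonglongrightarrow> (\<integral>x. u x * F' x v \<partial>lebesgue)"
    if X: "\<forall>n. X n \<noteq> 0" "X \<longlonglongrightarrow> 0" for X :: "nat \<Rightarrow> real"
  proof -
    obtain n0 where n0: "\<And>n. n \<ge> n0 \<Longrightarrow> \<bar>X n\<bar> \<le> 1"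
      using X(2) by (metis (no_types, lifting) LIMSEQ_D diff_zero less_eq_real_def real_norm_def zero_less_one)
    have "(\<lambda>n. \<integral>x. u x * ((F (x + X (n + n0) *\<^sub>R v) - F x) / X (n + n0)) \<partial>lebesgue)
          \<longlonglongrightarrow> (\<integral>x. u x * F' x v \<partial>lebesgue)"
    proof (rule integral_dominated_convergence[where w = w])
      show "(\<lambda>x. u x * F' x v) \<in> borel_measurable lebesgue" using u mF' by simp
      show "(\<lambda>x. u x * ((F (x + X (n + n0) *\<^sub>R v) - F x) / X (n + n0))) \<in> borel_measurable lebesgue" for n
        using u mF[of "X (n + n0) *\<^sub>R v"] mF[of 0]
        by (intro borel_measurable_times borel_measurable_divide borel_measurable_diff) simp_all
      show "integrable lebesgue w" by fact
      have "(\<lambda>n. (F (x + X n *\<^sub>R v) - F x) / X n) \<longlonglongrightarrow> F' x v" for x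
        using X filterlim_compose[OF lim[of x], of X sequentially] by (auto simp: filterlim_at)
      then have "(\<lambda>n. u x * ((F (x + X (n + n0) *\<^sub>R v) - F x) / X (n + n0))) \<longlonglongrightarrow> u x * F' x v" for x
        by (intro tendsto_mult_left LIMSEQ_ignore_initial_segment)
      then show "AE x in lebesgue. (\<lambda>n. u x * ((F (x + X (n + n0) *\<^sub>R v) - F x) / X (n + n0))) \<longlonglongrightarrow> u x * F' x v"
        by simp
      show "AE x in lebesgue. norm (u x * ((F (x + X (n + n0) *\<^sub>R v) - F x) / X (n + n0))) \<le> w x" for n
        using u(2)
      proof eventually_elim
        case (elim x)
        let ?h = "X (n + n0)"
        have h: "\<bar>?h\<bar> \<le> 1" "?h \<noteq> 0" using n0[of "n + n0"] X by auto
        show ?case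
        proof (cases "norm x \<le> r + norm v")
          case True
          have "\<bar>(F (x + ?h *\<^sub>R v) - F x) / ?h\<bar> \<le> \<bar>C\<bar>"
            using diff[of x ?h] h by (simp add: divide_simps)
          then have "\<bar>u x\<bar> * \<bar>(F (x + ?h *\<^sub>R v) - F x) / ?h\<bar> \<le> \<bar>K\<bar> * \<bar>C\<bar>"
            using elim by (intro mult_mono) auto
          then show ?thesis using True by (simp add: w_def abs_mult)
        next
          case False
          have "norm x \<le> norm (x + ?h *\<^sub>R v) + norm (?h *\<^sub>R v)"
            using norm_triangle_ineq4[of "x + ?h *\<^sub>R v" "?h *\<^sub>R v"] by simp
          moreover have "norm (?h *\<^sub>R v) \<le> norm v" using h by (simp add: mult_left_le_one_le)
          ultimately have "norm (x + ?h *\<^sub>R v) > r" using False by linarith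
          moreover have "norm x > r" using False norm_ge_zero[of v] by linarith
          ultimately show ?thesis using supp by (simp add: w_def)
        qed
      qed
    qed
    then show ?thesis by (rule LIMSEQ_offset)
  qed
  then show ?thesis unfolding tendsto_at_iff_sequentially comp_def by auto
qed

lemma integral_translation_lebesgue:
  fixes F :: "'a::euclidean_space \<Rightarrow> real"
  assumes "continuous_on UNIV F"
  shows "(\<integral>x. F (x + a) \<partial>lebesgue) = (\<integral>x. F x \<partial>lebesgue)"
proof -
  have m: "F \<in> borel_measurable borel" using assms by (simp add: borel_measurable_continuous_onI)
  then have m': "(\<lambda>x. F (x + a)) \<in> borel_measurable borel" by measurable
  have "(\<integral>x. F x \<partial>lborel) = (\<integral>x. F x \<partial>distr lborel borel ((+) a))"
    by (simp add: lborel_distr_plus)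
  also have "\<dots> = (\<integral>x. F (a + x) \<partial>lborel)"
    using m by (subst integral_distr) auto
  finally show ?thesis using m m' by (simp add: integral_completion add.commute)
qed

text \<open>By translation invariance every difference quotient has integral 0, and the integral of
  the derivative is their limit. No iterated integration is involved.\<close>

lemma integral_derivative_compact_support:
  fixes F :: "'a::euclidean_space \<Rightarrow> real"
  assumes deriv: "\<And>x. (F has_derivative F' x) (at x)"
    and cont: "continuous_on UNIV (\<lambda>x. F' x v)"
    and supp: "\<And>x. norm x > r \<Longrightarrow> F x = 0"
  shows "(\<integral>x. F' x v \<partial>lebesgue) = 0"
proof -
  have Fcont: "continuous_on UNIV F"
    using deriv by (meson continuous_at_imp_continuous_on has_derivative_continuous)
  have "((\<lambda>h. \<integral>x. 1 * ((F (x + h *\<^sub>R v) - F x) / h) \<partial>lebesgue) \<longlongrightarrow> (\<integral>x. 1 * F' x v \<partial>lebesgue)) (at 0)"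
    using assms by (intro difference_quotient_integral[where r = r and K = 1]) auto
  moreover have "(\<integral>x. 1 * ((F (x + h *\<^sub>R v) - F x) / h) \<partial>lebesgue) = 0" for h
  proof -
    have "integrable lebesgue (\<lambda>x. 1 * F (x + h *\<^sub>R v))"
    proof (rule integrable_bounded_times[where r = "r + norm (h *\<^sub>R v)" and K = 1])
      show "continuous_on UNIV (\<lambda>x. F (x + h *\<^sub>R v))"
        by (intro continuous_on_compose2[OF Fcont] continuous_intros) auto
      fix x :: 'a assume "norm x > r + norm (h *\<^sub>R v)"
      then show "F (x + h *\<^sub>R v) = 0"
        using norm_triangle_ineq4[of "x + h *\<^sub>R v" "h *\<^sub>R v"] by (intro supp) simp
    qed auto
    moreover have "integrable lebesgue (\<lambda>x. 1 * F x)"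
      using Fcont supp by (intro integrable_bounded_times[where r = r and K = 1]) auto
    ultimately show ?thesis
      using integral_translation_lebesgue[OF Fcont] by (simp add: Bochner_Integration.integral_diff)
  qed
  ultimately have "((\<lambda>h. 0) \<longlongrightarrow> (\<integral>x. 1 * F' x v \<partial>lebesgue)) (at (0::real))"
    by (simp only:)
  then show ?thesis using tendsto_unique[OF _ tendsto_const, of "at (0::real)"] by fastforce
qed

lemma test_function_has_derivative:
  "test_function \<phi> \<Longrightarrow> (\<phi> has_derivative frechet_derivative \<phi> (at x)) (at x)"
  unfolding test_function_def using frechet_derivative_works by (metis Ck.simps(2))

lemma test_function_continuous: "test_function \<phi> \<Longrightarrow> continuous_on UNIV \<phi>"
  using test_function_has_derivative
  by (meson continuous_at_imp_continuous_on has_derivative_continuous)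

lemma test_function_continuous_derivative:
  assumes "test_function \<phi>"
  shows "continuous_on UNIV (\<lambda>x. frechet_derivative \<phi> (at x) v)"
proof -
  have "Ck (Suc 0) \<phi>" using assms by (auto simp: test_function_def)
  then have c: "continuous_on UNIV (\<lambda>x. frechet_derivative \<phi> (at x) b)" if "b \<in> Basis" for b
    using that by simp
  have "frechet_derivative \<phi> (at x) v = (\<Sum>b\<in>Basis. (v \<bullet> b) * frechet_derivative \<phi> (at x) b)" for x
    by (rule linear_eq_sum_Basis[OF has_derivative_linear[OF test_function_has_derivative[OF assms]]])
  then show ?thesis using c by (auto intro!: continuous_intros)
qed

lemma test_function_support:
  fixes \<phi> :: "'a::euclidean_space \<Rightarrow> real"
  assumes "test_function \<phi>"
  obtains r where "\<And>x. norm x > r \<Longrightarrow> \<phi> x = 0"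
proof -
  have "bounded (closure {x. \<phi> x \<noteq> 0})"
    using assms by (auto simp: test_function_def compact_imp_bounded)
  then obtain r where "\<And>x. x \<in> closure {x. \<phi> x \<noteq> 0} \<Longrightarrow> norm x \<le> r"
    by (auto simp: bounded_iff)
  then have "\<And>x. norm x > r \<Longrightarrow> \<phi> x = 0"
    using closure_subset[of "{x. \<phi> x \<noteq> 0}"] by force
  then show ?thesis by (rule that)
qed

text \<open>Integration by parts: the derivative of the compactly supported product \<psi>\<phi> has
  integral 0. This is how a concrete function is recognised as a competitor in the supremum.\<close>

lemma W1_infinity_C1:
  fixes \<psi> :: "'a::euclidean_space \<Rightarrow> real"
  assumes deriv: "\<And>x. (\<psi> has_derivative (\<lambda>h. G x \<bullet> h)) (at x)"
    and G: "continuous_on UNIV G" "\<And>x. norm (G x) \<le> K"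
    and bdd: "\<And>x. \<bar>\<psi> x\<bar> \<le> M"
  shows "W1_infinity \<psi> G"
proof -
  have c: "continuous_on UNIV \<psi>"
    using deriv by (meson continuous_at_imp_continuous_on has_derivative_continuous)
  have m: "\<psi> \<in> borel_measurable lebesgue" "G \<in> borel_measurable lebesgue"
    using borel_measurable_continuous_onI[OF c] borel_measurable_continuous_onI[OF G(1)]
    by (auto intro!: measurable_completion)
  have "(\<integral>x. \<psi> x * frechet_derivative \<phi> (at x) b \<partial>lebesgue) = - (\<integral>x. (G x \<bullet> b) * \<phi> x \<partial>lebesgue)"
    if \<phi>: "test_function \<phi>" for \<phi> b
  proof -
    obtain r where r: "\<And>x. norm x > r \<Longrightarrow> \<phi> x = 0" by (rule test_function_support[OF \<phi>]) auto
    let ?D = "\<lambda>x. frechet_derivative \<phi> (at x)"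
    note d\<phi> = test_function_has_derivative[OF \<phi>]
    note cD = test_function_continuous_derivative[OF \<phi>, of b]
    note c\<phi> = test_function_continuous[OF \<phi>]
    have cG: "continuous_on UNIV (\<lambda>x. G x \<bullet> b)" using G by (intro continuous_intros)
    have D0: "?D x b = 0" if "norm x > r" for x
      using has_derivative_outside_support[OF d\<phi> r that] by simp
    have i1: "integrable lebesgue (\<lambda>x. 1 * (\<psi> x * ?D x b))"
      using c cD D0 by (intro integrable_bounded_times[where r = r and K = 1]) (auto intro!: continuous_intros)
    have i2: "integrable lebesgue (\<lambda>x. 1 * ((G x \<bullet> b) * \<phi> x))"
      using cG c\<phi> r by (intro integrable_bounded_times[where r = r and K = 1]) (auto intro!: continuous_intros)
    have "(\<integral>x. \<psi> x * ?D x b + (G x \<bullet> b) * \<phi> x \<partial>lebesgue) = 0"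
    proof (rule integral_derivative_compact_support)
      show "((\<lambda>x. \<psi> x * \<phi> x) has_derivative (\<lambda>h. \<psi> x * ?D x h + (G x \<bullet> h) * \<phi> x)) (at x)" for x
        by (rule has_derivative_mult[OF deriv d\<phi>])
      show "continuous_on UNIV (\<lambda>x. \<psi> x * ?D x b + (G x \<bullet> b) * \<phi> x)"
        by (intro continuous_on_add continuous_on_mult c cD cG c\<phi>)
      show "\<psi> x * \<phi> x = 0" if "norm x > r" for x using r[OF that] by simp
    qed
    then show ?thesis using i1 i2 by simp
  qed
  then show ?thesis using m bdd G
    unfolding W1_infinity_def L_infinity_def by (auto intro!: AE_I2 exI)
qed

section \<open>Smooth bump functions\<close>

lemma Ck_Suc_imp: "Ck (Suc k) f \<Longrightarrow> Ck k f"
proof (induction k arbitrary: f)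
  case 0
  then show ?case
    by (auto intro!: continuous_at_imp_continuous_on differentiable_imp_continuous_within)
qed auto

lemma Ck_SucI:
  assumes "\<And>x. (f has_derivative f' x) (at x)" and "\<And>b. b \<in> Basis \<Longrightarrow> Ck k (\<lambda>x. f' x b)"
  shows "Ck (Suc k) f"
proof -
  have "frechet_derivative f (at x) = f' x" for x
    using frechet_derivative_at[OF assms(1)] by simp
  with assms show ?thesis by (auto simp: differentiable_def)
qed

lemma Ck_SucD:
  assumes "Ck (Suc k) f"
  shows "(f has_derivative frechet_derivative f (at x)) (at x)"
    and "b \<in> Basis \<Longrightarrow> Ck k (\<lambda>x. frechet_derivative f (at x) b)"
  using assms frechet_derivative_works by auto

lemma Ck_const: "Ck k (\<lambda>x. c)"
proof (induction k arbitrary: c)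
  case (Suc k)
  show ?case by (rule Ck_SucI[OF has_derivative_const]) (rule Suc)
qed auto

lemma Ck_inner: "Ck k (\<lambda>x. (x - w) \<bullet> b)"
proof (cases k)
  case (Suc j)
  show ?thesis unfolding Suc
    by (rule Ck_SucI[where f' = "\<lambda>x h. h \<bullet> b"]) (auto intro!: derivative_eq_intros Ck_const)
qed (auto intro!: continuous_intros)

lemma Ck_add: "Ck k f \<Longrightarrow> Ck k g \<Longrightarrow> Ck k (\<lambda>x. f x + g x)"
proof (induction k arbitrary: f g)
  case 0
  then show ?case by (auto intro!: continuous_intros)
next
  case (Suc k)
  show ?case
    by (rule Ck_SucI[OF has_derivative_add[OF Ck_SucD(1)[OF Suc.prems(1)] Ck_SucD(1)[OF Suc.prems(2)]]])
      (use Suc Ck_SucD(2) in blast)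
qed

lemma Ck_mult: "Ck k f \<Longrightarrow> Ck k g \<Longrightarrow> Ck k (\<lambda>x. f x * g x :: real)"
proof (induction k arbitrary: f g)
  case 0
  then show ?case by (auto intro!: continuous_intros)
next
  case (Suc k)
  show ?case
    by (rule Ck_SucI[OF has_derivative_mult[OF Ck_SucD(1)[OF Suc.prems(1)] Ck_SucD(1)[OF Suc.prems(2)]]])
      (intro Ck_add Suc.IH Ck_SucD(2)[OF Suc.prems(1)] Ck_SucD(2)[OF Suc.prems(2)] Ck_Suc_imp[OF Suc.prems(1)]
        Ck_Suc_imp[OF Suc.prems(2)])
qed

text \<open>
  The family \<open>exp (- 1 / t) t\<^sup>-\<^sup>j\<close> (extended by \<open>0\<close>) spans a space closed under differentiation,
  so smoothness of the bump follows by induction with \<open>j\<close> arbitrary.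
\<close>

definition flat :: "nat \<Rightarrow> real \<Rightarrow> real" where
  "flat j t = (if t > 0 then exp (- inverse t) * inverse t ^ j else 0)"

text \<open>Keeping the single term of order j + 2 of the series of exp (1/t) leaves two spare
  powers of t, which makes the difference quotient of \<open>flat j\<close> at 0 tend to 0.\<close>

lemma flat_le: "0 < t \<Longrightarrow> flat j t \<le> fact (j + 2) * t\<^sup>2"
proof -
  assume t: "0 < t"
  have "inverse t ^ (j + 2) / fact (j + 2) \<le> exp (inverse t)"
  proof -
    have "(\<lambda>k. inverse t ^ k / fact k) sums exp (inverse t)"
      using exp_converges[of "inverse t"] by (simp add: divide_inverse mult.commute)
    from sum_le_suminf[OF sums_summable[OF this], of "{j + 2}"] sums_unique[OF this] t
    show ?thesis by simp
  qed
  then have "inverse t ^ j * (inverse t)\<^sup>2 \<le> fact (j + 2) * exp (inverse t)"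
    by (simp add: power_add divide_le_eq mult_ac power2_eq_square)
  then have "inverse t ^ j * (inverse t)\<^sup>2 * (t\<^sup>2 * exp (- inverse t))
      \<le> fact (j + 2) * exp (inverse t) * (t\<^sup>2 * exp (- inverse t))"
    by (rule mult_right_mono) simp
  moreover have "(inverse t)\<^sup>2 * t\<^sup>2 = 1" using t by (simp add: power_inverse)
  moreover have "exp (inverse t) * exp (- inverse t) = 1" by (simp add: exp_minus)
  moreover have "inverse t ^ j * (inverse t)\<^sup>2 * (t\<^sup>2 * exp (- inverse t))
      = inverse t ^ j * exp (- inverse t) * ((inverse t)\<^sup>2 * t\<^sup>2)"
    by (simp only: mult_ac)
  moreover have "fact (j + 2) * exp (inverse t) * (t\<^sup>2 * exp (- inverse t))
      = fact (j + 2) * t\<^sup>2 * (exp (inverse t) * exp (- inverse t))"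
    by (simp only: mult_ac)
  ultimately have "inverse t ^ j * exp (- inverse t) \<le> fact (j + 2) * t\<^sup>2"
    by (simp only: mult_1_right)
  then show ?thesis using t by (simp add: flat_def mult_ac)
qed

lemma flat_nonneg: "flat j t \<ge> 0" by (simp add: flat_def)

lemma flat_has_derivative:
  "(flat j has_field_derivative flat (j + 2) t - real j * flat (j + 1) t) (at t)"
proof -
  consider "t > 0" | "t < 0" | "t = 0" by linarith
  then show ?thesis
  proof cases
    case 1
    have "((\<lambda>t. exp (- inverse t) * inverse t ^ j) has_field_derivative
        exp (- inverse t) * (inverse t)\<^sup>2 * inverse t ^ j
        - exp (- inverse t) * (real j * inverse t ^ (j - 1) * (inverse t)\<^sup>2)) (at t)"
      using 1 by (auto intro!: derivative_eq_intros simp: power2_eq_square)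
    moreover have "exp (- inverse t) * (inverse t)\<^sup>2 * inverse t ^ j
        - exp (- inverse t) * (real j * inverse t ^ (j - 1) * (inverse t)\<^sup>2)
        = flat (j + 2) t - real j * flat (j + 1) t"
      using 1 by (cases j) (simp_all add: flat_def power2_eq_square algebra_simps)
    ultimately have "((\<lambda>t. exp (- inverse t) * inverse t ^ j) has_field_derivative
        flat (j + 2) t - real j * flat (j + 1) t) (at t)"
      by simp
    then show ?thesis
      by (rule has_field_derivative_transform_within_open[where S = "{0<..}"]) (use 1 in \<open>auto simp: flat_def\<close>)
  next
    case 2
    have "((\<lambda>t. 0) has_field_derivative flat (j + 2) t - real j * flat (j + 1) t) (at t)"
      using 2 by (simp add: flat_def)
    then show ?thesis
      by (rule has_field_derivative_transform_within_open[where S = "{..<0}"]) (use 2 in \<open>auto simp: flat_def\<close>)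
  next
    case 3
    have "((\<lambda>h. flat j h / h) \<longlongrightarrow> 0) (at 0)"
    proof (rule Lim_null_comparison)
      show "eventually (\<lambda>h. norm (flat j h / h) \<le> fact (j + 2) * \<bar>h\<bar>) (at 0)"
      proof (rule eventuallyI)
        fix h :: real
        show "norm (flat j h / h) \<le> fact (j + 2) * \<bar>h\<bar>"
        proof (cases "h > 0")
          case True
          then show ?thesis using flat_le[of h j] flat_nonneg[of j h]
            by (simp add: divide_simps power2_eq_square mult_ac)
        next
          case False
          then have "norm (flat j h / h) = 0" by (simp add: flat_def)
          moreover have "0 \<le> fact (j + 2) * \<bar>h\<bar>" by (intro mult_nonneg_nonneg) auto
          ultimately show ?thesis by linarith
        qed
      qed
      show "((\<lambda>h. fact (j + 2) * \<bar>h\<bar>) \<longlongrightarrow> (0::real)) (at 0)"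
        by (rule tendsto_eq_intros refl | simp)+
    qed
    then show ?thesis using 3 by (simp add: has_field_derivative_iff flat_def)
  qed
qed

lemma Ck_flat:
  fixes w :: "'a::euclidean_space"
  shows "Ck k (\<lambda>x. flat j (e - (x - w) \<bullet> (x - w)))"
proof (induction k arbitrary: j)
  case 0
  have "continuous_on UNIV (flat j)"
    using flat_has_derivative by (meson DERIV_isCont continuous_at_imp_continuous_on)
  moreover have "continuous_on UNIV (\<lambda>x. e - (x - w) \<bullet> (x - w))" by (intro continuous_intros)
  ultimately have "continuous_on UNIV (\<lambda>x. flat j (e - (x - w) \<bullet> (x - w)))"
    by (rule continuous_on_compose2) simp
  then show ?case by simp
next
  case (Suc k)
  let ?u = "\<lambda>x. e - (x - w) \<bullet> (x - w)"
  show ?case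
  proof (rule Ck_SucI)
    show "((\<lambda>x. flat j (?u x)) has_derivative
       (\<lambda>h. (flat (j + 2) (?u x) + (- real j) * flat (j + 1) (?u x)) * (-2 * ((x - w) \<bullet> h)))) (at x)" for x
    proof -
      have "(?u has_derivative (\<lambda>h. -2 * ((x - w) \<bullet> h))) (at x)"
        by (auto intro!: derivative_eq_intros simp: inner_commute)
      from has_derivative_compose[OF this flat_has_derivative[unfolded has_field_derivative_def]]
      show ?thesis by simp
    qed
    show "Ck k (\<lambda>x. (flat (j + 2) (?u x) + (- real j) * flat (j + 1) (?u x)) * (-2 * ((x - w) \<bullet> b)))" for b
      by (intro Ck_mult Ck_add Ck_const Suc Ck_inner)
  qed
qed

text \<open>The squared distance keeps the function smooth at the centre. The bump is not
  normalised; its total mass is carried along in the estimates and divided out at the end.\<close>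

definition bump :: "real \<Rightarrow> 'a::euclidean_space \<Rightarrow> 'a \<Rightarrow> real" where
  "bump e w x = flat 0 (e\<^sup>2 - (x - w) \<bullet> (x - w))"

lemma bump_nonneg: "bump e w x \<ge> 0"
  by (simp add: bump_def flat_nonneg)

lemma bump_eq_0: "e > 0 \<Longrightarrow> norm (x - w) \<ge> e \<Longrightarrow> bump e w x = 0"
  using power_mono[of e "norm (x - w)" 2] by (auto simp: bump_def flat_def dot_square_norm not_less)

lemma bump_pos: "norm (x - w) < e \<Longrightarrow> bump e w x > 0"
  using power_strict_mono[of "norm (x - w)" e 2] by (simp add: bump_def flat_def dot_square_norm)

lemma bump_translate: "bump e (w + a) x = bump e w (x - a)"
  by (simp add: bump_def algebra_simps)

lemma test_function_bump:
  assumes "e > 0"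
  shows "test_function (bump e w)"
proof -
  have "closure {x. bump e w x \<noteq> 0} \<subseteq> cball w e"
  proof (rule closure_minimal)
    show "{x. bump e w x \<noteq> 0} \<subseteq> cball w e"
      using bump_eq_0[OF assms, of _ w] by (force simp: dist_norm norm_minus_commute)
  qed auto
  then have "compact (closure {x. bump e w x \<noteq> 0})"
    by (meson bounded_cball bounded_subset compact_eq_bounded_closed closed_closure)
  moreover have "Ck k (bump e w)" for k
    unfolding bump_def[abs_def] by (rule Ck_flat)
  ultimately show ?thesis by (simp add: test_function_def)
qed

section \<open>Increments controlled by distributional gradients\<close>

text \<open>The definition tests basis directions only; both sides are linear in the direction once
  each coordinate integrand is known to be integrable.\<close>

lemma W1_infinity_directional:
  fixes \<psi> :: "'a::euclidean_space \<Rightarrow> real"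
  assumes W: "W1_infinity \<psi> G" and \<phi>: "test_function \<phi>"
  shows "(\<integral>x. \<psi> x * frechet_derivative \<phi> (at x) v \<partial>lebesgue) = - (\<integral>x. (G x \<bullet> v) * \<phi> x \<partial>lebesgue)"
proof -
  let ?D = "\<lambda>x. frechet_derivative \<phi> (at x)"
  obtain r where r: "\<And>x. norm x > r \<Longrightarrow> \<phi> x = 0" by (rule test_function_support[OF \<phi>]) auto
  note d\<phi> = test_function_has_derivative[OF \<phi>]
  have D0: "?D x b = 0" if "norm x > r" for x b
    using has_derivative_outside_support[OF d\<phi> r that] by simp
  obtain K where K: "\<psi> \<in> borel_measurable lebesgue" "AE x in lebesgue. \<bar>\<psi> x\<bar> \<le> K"
    using W by (auto simp: W1_infinity_def L_infinity_def)
  obtain L where L: "G \<in> borel_measurable lebesgue" "AE x in lebesgue. norm (G x) \<le> L"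
    using W by (auto simp: W1_infinity_def L_infinity_def)
  have i1: "integrable lebesgue (\<lambda>x. \<psi> x * ?D x b)" for b
    using D0 by (intro integrable_bounded_times[OF K] test_function_continuous_derivative \<phi>) auto
  have i2: "integrable lebesgue (\<lambda>x. (G x \<bullet> b) * \<phi> x)" if "b \<in> Basis" for b
  proof (rule integrable_bounded_times)
    show "(\<lambda>x. G x \<bullet> b) \<in> borel_measurable lebesgue" using L by simp
    show "AE x in lebesgue. \<bar>G x \<bullet> b\<bar> \<le> L"
      using L(2) by eventually_elim (use Basis_le_norm[OF that] order_trans in blast)
  qed (use r test_function_continuous[OF \<phi>] in auto)
  have lin: "?D x v = (\<Sum>b\<in>Basis. (v \<bullet> b) * ?D x b)" for x
    by (rule linear_eq_sum_Basis[OF has_derivative_linear[OF d\<phi>]])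
  have "(\<integral>x. \<psi> x * ?D x v \<partial>lebesgue) = (\<integral>x. (\<Sum>b\<in>Basis. (v \<bullet> b) * (\<psi> x * ?D x b)) \<partial>lebesgue)"
    by (simp add: lin sum_distrib_left mult_ac)
  also have "\<dots> = (\<Sum>b\<in>Basis. (v \<bullet> b) * (\<integral>x. \<psi> x * ?D x b \<partial>lebesgue))"
    using i1 by (subst Bochner_Integration.integral_sum) auto
  also have "\<dots> = - (\<Sum>b\<in>Basis. (v \<bullet> b) * (\<integral>x. (G x \<bullet> b) * \<phi> x \<partial>lebesgue))"
    using W \<phi> by (simp add: W1_infinity_def sum_negf)
  also have "(\<Sum>b\<in>Basis. (v \<bullet> b) * (\<integral>x. (G x \<bullet> b) * \<phi> x \<partial>lebesgue))
      = (\<integral>x. (\<Sum>b\<in>Basis. (v \<bullet> b) * ((G x \<bullet> b) * \<phi> x)) \<partial>lebesgue)"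
    using i2 by (subst Bochner_Integration.integral_sum) auto
  also have "\<dots> = (\<integral>x. (G x \<bullet> v) * \<phi> x \<partial>lebesgue)"
    by (simp add: euclidean_inner[of _ v] sum_distrib_right sum_distrib_left mult_ac)
  finally show ?thesis .
qed

text \<open>
  Translating the bump along the segment, the mollification of \<open>\<psi>\<close> is differentiable in the
  parameter, with derivative the average of \<open>G \<bullet> v\<close> against the bump.
\<close>

lemma W1_infinity_segment_mollified:
  fixes \<psi> :: "'a::euclidean_space \<Rightarrow> real"
  assumes W: "W1_infinity \<psi> G" and e: "e > 0"
    and G: "AE z in lebesgue. \<forall>t\<in>{0..1}. norm (z - (x + t *\<^sub>R v)) < e \<longrightarrow> \<bar>G z \<bullet> v\<bar> \<le> M"
  shows "\<bar>(\<integral>z. \<psi> z * bump e (x + v) z \<partial>lebesgue) - (\<integral>z. \<psi> z * bump e x z \<partial>lebesgue)\<bar>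
      \<le> M * (\<integral>z. bump e x z \<partial>lebesgue)"
proof -
  let ?b = "\<lambda>t. bump e (x + t *\<^sub>R v)"
  let ?g = "\<lambda>t. \<integral>z. \<psi> z * ?b t z \<partial>lebesgue"
  define I where "I = (\<integral>z. bump e x z \<partial>lebesgue)"
  have tf: "test_function (?b t)" for t by (rule test_function_bump[OF e])
  obtain K where K: "\<psi> \<in> borel_measurable lebesgue" "AE x in lebesgue. \<bar>\<psi> x\<bar> \<le> K"
    using W by (auto simp: W1_infinity_def L_infinity_def)
  obtain L where L: "G \<in> borel_measurable lebesgue" "AE x in lebesgue. norm (G x) \<le> L"
    using W by (auto simp: W1_infinity_def L_infinity_def)
  have supp: "?b t z = 0" if "norm z > e + norm (x + t *\<^sub>R v)" for t z
    using that norm_triangle_ineq2[of z "x + t *\<^sub>R v"] by (intro bump_eq_0[OF e]) linarith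
  have int: "integrable lebesgue (\<lambda>z. u z * ?b t z)"
    if "u \<in> borel_measurable lebesgue" "AE x in lebesgue. \<bar>u x\<bar> \<le> K" for u t K
    using that supp by (intro integrable_bounded_times test_function_continuous tf)
  have I: "(\<integral>z. ?b t z \<partial>lebesgue) = I" for t
    using integral_translation_lebesgue[OF test_function_continuous[OF tf[of 0]], of "- (t *\<^sub>R v)"]
    by (simp add: I_def bump_translate)
  \<comment> \<open>Moving the centre by \<open>h *\<^sub>R v\<close> is the same as evaluating at
    \<open>z - h *\<^sub>R v\<close>, so the parameter derivative of the bump is its derivative
    along \<open>- v\<close>. This sign cancels the one in the definition of the distributional
    gradient.\<close>
  have deriv: "(?g has_field_derivative (\<integral>z. (G z \<bullet> v) * ?b t z \<partial>lebesgue)) (at t)" for t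
  proof -
    have "((\<lambda>h. \<integral>z. \<psi> z * ((?b t (z + h *\<^sub>R (- v)) - ?b t z) / h) \<partial>lebesgue)
        \<longlongrightarrow> (\<integral>z. \<psi> z * frechet_derivative (?b t) (at z) (- v) \<partial>lebesgue)) (at 0)"
      using supp K by (intro difference_quotient_integral test_function_has_derivative
          test_function_continuous_derivative tf) auto
    moreover have "?b t (z + h *\<^sub>R (- v)) = ?b (t + h) z" for z h
      using bump_translate[of e "x + t *\<^sub>R v" "h *\<^sub>R v" z] by (simp add: algebra_simps)
    moreover have "(\<integral>z. \<psi> z * ((?b (t + h) z - ?b t z) / h) \<partial>lebesgue) = (?g (t + h) - ?g t) / h" for h
    proof -
      have "(\<integral>z. \<psi> z * ((?b (t + h) z - ?b t z) / h) \<partial>lebesgue)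
          = (\<integral>z. (\<psi> z * ?b (t + h) z - \<psi> z * ?b t z) / h \<partial>lebesgue)"
        by (simp only: times_divide_eq_right right_diff_distrib)
      also have "\<dots> = (\<integral>z. \<psi> z * ?b (t + h) z - \<psi> z * ?b t z \<partial>lebesgue) / h"
        by (rule integral_divide_zero)
      also have "\<dots> = (?g (t + h) - ?g t) / h"
        by (simp only: Bochner_Integration.integral_diff[OF int[OF K] int[OF K]])
      finally show ?thesis .
    qed
    moreover have "(\<integral>z. \<psi> z * frechet_derivative (?b t) (at z) (- v) \<partial>lebesgue)
        = (\<integral>z. (G z \<bullet> v) * ?b t z \<partial>lebesgue)"
      by (subst W1_infinity_directional[OF W tf]) simp
    ultimately have "((\<lambda>h. (?g (t + h) - ?g t) / h) \<longlongrightarrow> (\<integral>z. (G z \<bullet> v) * ?b t z \<partial>lebesgue)) (at 0)"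
      by (simp only:)
    then show ?thesis by (simp only: DERIV_def)
  qed
  have "AE x in lebesgue. \<bar>G x \<bullet> v\<bar> \<le> L * norm v"
    using L(2)
  proof eventually_elim
    case (elim x)
    then show ?case
      using Cauchy_Schwarz_ineq2[of "G x" v] mult_right_mono[of "norm (G x)" L "norm v"] by simp
  qed
  then have intG: "integrable lebesgue (\<lambda>z. (G z \<bullet> v) * ?b t z)" for t
    using L by (intro int) auto
  have bound: "norm (\<integral>z. (G z \<bullet> v) * ?b t z \<partial>lebesgue) \<le> M * I" if t: "t \<in> {0..1}" for t
  proof -
    have "norm (\<integral>z. (G z \<bullet> v) * ?b t z \<partial>lebesgue) \<le> (\<integral>z. norm ((G z \<bullet> v) * ?b t z) \<partial>lebesgue)"
      by (rule integral_norm_bound)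
    also have "\<dots> \<le> (\<integral>z. M * ?b t z \<partial>lebesgue)"
    proof (rule integral_mono_AE)
      show "integrable lebesgue (\<lambda>z. M * ?b t z)" by (rule int[of "\<lambda>z. M" "\<bar>M\<bar>"]) auto
      show "integrable lebesgue (\<lambda>z. norm ((G z \<bullet> v) * ?b t z))" using intG by (rule integrable_norm)
      show "AE z in lebesgue. norm ((G z \<bullet> v) * ?b t z) \<le> M * ?b t z"
        using G
      proof eventually_elim
        case (elim z)
        show ?case
        proof (cases "norm (z - (x + t *\<^sub>R v)) < e")
          case True
          then show ?thesis
            using elim t bump_nonneg[of e "x + t *\<^sub>R v" z] by (auto simp: abs_mult intro: mult_right_mono)
        qed (use bump_eq_0[OF e, of z "x + t *\<^sub>R v"] in simp)
      qed
    qed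
    also have "\<dots> = M * I" by (simp add: I)
    finally show ?thesis .
  qed
  have "norm (?g 1 - ?g 0) \<le> M * I * norm (1 - 0 :: real)"
    using deriv bound
    by (intro field_differentiable_bound[where S = "{0..1}"
          and f' = "\<lambda>t. \<integral>z. (G z \<bullet> v) * ?b t z \<partial>lebesgue"])
      (auto intro: has_field_derivative_at_within)
  then show ?thesis by (simp add: I_def)
qed

text \<open>Continuity of \<psi> at the two endpoints replaces averages by point values as the bump
  shrinks, each with error at most half of \<eta> times the mass. The gradient bound is assumed on a
  tube because the segment itself may be a null set.\<close>

lemma W1_infinity_segment:
  fixes \<psi> :: "'a::euclidean_space \<Rightarrow> real"
  assumes W: "W1_infinity \<psi> G" and cont: "continuous_on UNIV \<psi>" and e: "e > 0"
    and G: "AE z in lebesgue. \<forall>t\<in>{0..1}. norm (z - (x + t *\<^sub>R v)) < e \<longrightarrow> \<bar>G z \<bullet> v\<bar> \<le> M"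
  shows "\<bar>\<psi> (x + v) - \<psi> x\<bar> \<le> M"
proof (rule field_le_epsilon)
  fix \<eta> :: real assume \<eta>: "\<eta> > 0"
  have "\<exists>d>0. \<forall>z. norm (z - y) < d \<longrightarrow> \<bar>\<psi> z - \<psi> y\<bar> \<le> \<eta> / 2" for y
  proof -
    have "isCont \<psi> y" using cont by (simp add: continuous_on_eq_continuous_at)
    then obtain d where "d > 0" "\<And>z. dist z y < d \<Longrightarrow> dist (\<psi> z) (\<psi> y) < \<eta> / 2"
      using \<eta> unfolding continuous_at_eps_delta by (meson half_gt_zero)
    then show ?thesis by (intro exI[of _ d]) (force simp: dist_norm)
  qed
  then obtain d where d: "\<And>y. d y > 0" "\<And>y z. norm (z - y) < d y \<Longrightarrow> \<bar>\<psi> z - \<psi> y\<bar> \<le> \<eta> / 2"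
    by metis
  define r where "r = min e (min (d x) (d (x + v)))"
  have r: "r > 0" "r \<le> e" "r \<le> d x" "r \<le> d (x + v)" using d e by (auto simp: r_def)
  define I where "I = (\<integral>z. bump r x z \<partial>lebesgue)"
  have tf: "test_function (bump r y)" for y :: 'a by (rule test_function_bump[OF r(1)])
  have supp: "bump r y z = 0" if "norm z > r + norm y" for y z :: 'a
    using that norm_triangle_ineq2[of z y] by (intro bump_eq_0[OF r(1)]) linarith
  have int: "integrable lebesgue (\<lambda>z. u z * bump r y z)"
    if "u \<in> borel_measurable lebesgue" "AE x in lebesgue. \<bar>u x\<bar> \<le> K" for u K and y :: 'a
    using that supp by (intro integrable_bounded_times test_function_continuous tf)
  obtain K where K: "\<psi> \<in> borel_measurable lebesgue" "AE x in lebesgue. \<bar>\<psi> x\<bar> \<le> K"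
    using W by (auto simp: W1_infinity_def L_infinity_def)
  have Iy: "(\<integral>z. bump r y z \<partial>lebesgue) = I" for y :: 'a
    using integral_translation_lebesgue[OF test_function_continuous[OF tf[of x]], of "x - y"]
      bump_translate[of r x "y - x"] by (simp add: I_def algebra_simps)
  \<comment> \<open>The mass has to be divided out; it is positive because the bump is positive on a
    ball, which is not negligible.\<close>
  have "I > 0"
  proof -
    have i: "integrable lebesgue (bump r x)" using int[of "\<lambda>_. 1" 1 x] by simp
    have "I \<noteq> 0"
    proof
      assume "I = 0"
      then have "AE z in lebesgue. bump r x z = 0"
        using integral_nonneg_eq_0_iff_AE[OF i] bump_nonneg by (auto simp: I_def)
      then have "AE z in lebesgue. z \<notin> ball x r"
        by eventually_elim (use bump_pos[of _ x r] in \<open>force simp: dist_norm norm_minus_commute\<close>)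
      then have "negligible (ball x r)"
        by (simp add: negligible_iff_null_sets AE_iff_null_sets)
      then show False using r(1) by (simp add: open_not_negligible)
    qed
    moreover have "I \<ge> 0" unfolding I_def by (intro Bochner_Integration.integral_nonneg bump_nonneg)
    ultimately show ?thesis by simp
  qed
  have near: "\<bar>(\<integral>z. \<psi> z * bump r y z \<partial>lebesgue) - \<psi> y * I\<bar> \<le> \<eta> / 2 * I" if y: "r \<le> d y" for y :: 'a
  proof -
    have i1: "integrable lebesgue (\<lambda>z. \<psi> y * bump r y z)" by (rule int[of _ "\<bar>\<psi> y\<bar>"]) auto
    have "\<bar>(\<integral>z. \<psi> z * bump r y z \<partial>lebesgue) - \<psi> y * I\<bar>
        = \<bar>\<integral>z. \<psi> z * bump r y z - \<psi> y * bump r y z \<partial>lebesgue\<bar>"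
      using int[OF K, of y] i1 by (simp add: Bochner_Integration.integral_diff Iy)
    also have "\<dots> \<le> (\<integral>z. \<bar>\<psi> z * bump r y z - \<psi> y * bump r y z\<bar> \<partial>lebesgue)"
      by (rule integral_abs_bound)
    also have "\<dots> \<le> (\<integral>z. \<eta> / 2 * bump r y z \<partial>lebesgue)"
    proof (rule integral_mono)
      show "integrable lebesgue (\<lambda>z. \<bar>\<psi> z * bump r y z - \<psi> y * bump r y z\<bar>)"
        using int[OF K, of y] i1 by (intro integrable_abs Bochner_Integration.integrable_diff)
      show "integrable lebesgue (\<lambda>z. \<eta> / 2 * bump r y z)" by (rule int[of _ "\<bar>\<eta> / 2\<bar>"]) auto
      fix z
      have "\<bar>\<psi> z - \<psi> y\<bar> * bump r y z \<le> \<eta> / 2 * bump r y z"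
      proof (cases "norm (z - y) < r")
        case True
        with d(2)[of z y] y show ?thesis by (intro mult_right_mono bump_nonneg) simp
      qed (use bump_eq_0[OF r(1), of z y] in simp)
      then show "\<bar>\<psi> z * bump r y z - \<psi> y * bump r y z\<bar> \<le> \<eta> / 2 * bump r y z"
        using bump_nonneg[of r y z] by (simp add: abs_mult flip: left_diff_distrib)
    qed
    also have "\<dots> = \<eta> / 2 * I" by (simp add: Iy)
    finally show ?thesis .
  qed
  have "\<bar>(\<integral>z. \<psi> z * bump r (x + v) z \<partial>lebesgue) - (\<integral>z. \<psi> z * bump r x z \<partial>lebesgue)\<bar> \<le> M * I"
    unfolding I_def
  proof (rule W1_infinity_segment_mollified[OF W r(1)])
    show "AE z in lebesgue. \<forall>t\<in>{0..1}. norm (z - (x + t *\<^sub>R v)) < r \<longrightarrow> \<bar>G z \<bullet> v\<bar> \<le> M"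
      using G by eventually_elim (use r(2) in force)
  qed
  moreover have "\<bar>a - a'\<bar> \<le> M * I + (c + c)" if "\<bar>b - b'\<bar> \<le> M * I" "\<bar>b - a\<bar> \<le> c" "\<bar>b' - a'\<bar> \<le> c" for a a' b b' c
    using that by linarith
  ultimately have "\<bar>\<psi> (x + v) * I - \<psi> x * I\<bar> \<le> M * I + (\<eta> / 2 * I + \<eta> / 2 * I)"
    using near[of x] near[of "x + v"] r by blast
  also have "\<dots> = (M + \<eta>) * I" by (simp add: algebra_simps)
  finally have "\<bar>\<psi> (x + v) * I - \<psi> x * I\<bar> \<le> (M + \<eta>) * I" .
  then have "\<bar>\<psi> (x + v) - \<psi> x\<bar> * I \<le> (M + \<eta>) * I"
    using \<open>I > 0\<close> by (simp add: abs_mult flip: left_diff_distrib)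
  then show "\<bar>\<psi> (x + v) - \<psi> x\<bar> \<le> M + \<eta>" using \<open>I > 0\<close> by simp
qed

section \<open>Lower bound for the distance\<close>

text \<open>The two-sided bounds on the coefficients hold only off the origin, so the constraint is
  checked off x_1 = 0. This set lies in a coordinate hyperplane.\<close>

lemma AE_fst_neq_0: "AE z in lebesgue. fst (z :: (real ^ 'n) \<times> (real ^ 'm)) \<noteq> 0"
proof -
  obtain b :: "real ^ 'n" where b: "b \<in> Basis" using nonempty_Basis by blast
  have "negligible {z :: (real ^ 'n) \<times> (real ^ 'm). (b, 0) \<bullet> z = 0}"
    using b by (intro negligible_hyperplane) (auto simp: zero_prod_def)
  moreover have "{z :: (real ^ 'n) \<times> (real ^ 'm). fst z = 0} \<subseteq> {z. (b, 0) \<bullet> z = 0}"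
    by (auto simp: inner_prod_def)
  ultimately have "negligible {z :: (real ^ 'n) \<times> (real ^ 'm). fst z = 0}"
    by (rule negligible_subset)
  then have "AE z in lebesgue. z \<notin> {z :: (real ^ 'n) \<times> (real ^ 'm). fst z = 0}"
    by (intro AE_not_in) (simp add: negligible_iff_null_sets)
  then show ?thesis by simp
qed

definition admissible ::
  "(real ^ 'n \<Rightarrow> real) \<Rightarrow> (real ^ 'n \<Rightarrow> real) \<Rightarrow> ((real ^ 'n) \<times> (real ^ 'm) \<Rightarrow> real) \<Rightarrow> bool" where
  "admissible c1 c2 \<psi> \<longleftrightarrow> continuous_on UNIV \<psi> \<and>
     (\<exists>G. W1_infinity \<psi> G \<and>
        (AE x in lebesgue. c1 (fst x) * (norm (fst (G x)))\<^sup>2 + c2 (fst x) * (norm (snd (G x)))\<^sup>2 \<le> 1))"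

lemma riem_dist_admissible:
  "riem_dist c1 c2 y z = Sup {ereal (\<psi> y - \<psi> z) | \<psi>. admissible c1 c2 \<psi>}"
  by (simp add: riem_dist_def admissible_def)

text \<open>Squaring makes the truncation continuously differentiable, so that the cut-off
  paraboloid below falls under \<open>W1_infinity_C1\<close>.\<close>

lemma has_field_derivative_max_0_square:
  "((\<lambda>t::real. (max 0 t)\<^sup>2) has_field_derivative 2 * max 0 t) (at t)"
proof -
  consider "t > 0" | "t < 0" | "t = 0" by linarith
  then show ?thesis
  proof cases
    case 1
    have "((\<lambda>t. t\<^sup>2) has_field_derivative 2 * max 0 t) (at t)"
      using 1 by (auto intro!: derivative_eq_intros)
    then show ?thesis
      by (rule has_field_derivative_transform_within_open[where S = "{0<..}"]) (use 1 in auto)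
  next
    case 2
    have "((\<lambda>t. 0) has_field_derivative 2 * max 0 t) (at t)" using 2 by simp
    then show ?thesis
      by (rule has_field_derivative_transform_within_open[where S = "{..<0}"]) (use 2 in auto)
  next
    case 3
    have "((\<lambda>h::real. (max 0 h)\<^sup>2 / h) \<longlongrightarrow> 0) (at 0)"
    proof (rule Lim_null_comparison)
      show "eventually (\<lambda>h. norm ((max 0 h)\<^sup>2 / h) \<le> \<bar>h\<bar>) (at (0::real))"
        by (rule eventuallyI) (auto simp: max_def power2_eq_square)
      show "((\<lambda>h. \<bar>h\<bar>) \<longlongrightarrow> (0::real)) (at 0)"
        by (rule tendsto_eq_intros refl | simp)+
    qed
    then show ?thesis using 3 by (simp add: has_field_derivative_iff)
  qed
qed

text \<open>The competitor is B (1 - u)^2 where u < 1 and 0 elsewhere, with u = p |z_1 - x_1|^2 + q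
  |z_2 - x_2|^2; it equals B at x and 0 at y. Its x_1-gradient has length at most 4 B p |z_1 - x_1|,
  and p |z_1 - x_1|^2 \<le> u < 1 on the support absorbs one factor p of the square, leaving 16 B^2
  p; likewise for q. Hence the assumption on the coefficients is exactly what makes it admissible,
  and p, q can be adapted to each direction.\<close>

lemma riem_dist_ge:
  fixes c1 c2 :: "real ^ 'n \<Rightarrow> real" and x y :: "(real ^ 'n) \<times> (real ^ 'm)"
  assumes pq: "p \<ge> 0" "q \<ge> 0" and B: "B \<ge> 0"
    and c: "\<And>z. z \<noteq> 0 \<Longrightarrow> c1 z \<ge> 0" "\<And>z. z \<noteq> 0 \<Longrightarrow> c2 z \<ge> 0"
    and le: "\<And>z1 z2. z1 \<noteq> 0 \<Longrightarrow> p * (norm (z1 - fst x))\<^sup>2 + q * (norm (z2 - snd x))\<^sup>2 < 1 \<Longrightarrow>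
               c1 z1 * (16 * B\<^sup>2 * p) + c2 z1 * (16 * B\<^sup>2 * q) \<le> 1"
    and y: "p * (norm (fst y - fst x))\<^sup>2 + q * (norm (snd y - snd x))\<^sup>2 \<ge> 1"
  shows "ereal B \<le> riem_dist c1 c2 x y"
proof -
  define u where "u z = p * ((fst z - fst x) \<bullet> (fst z - fst x)) + q * ((snd z - snd x) \<bullet> (snd z - snd x))"
    for z :: "(real ^ 'n) \<times> (real ^ 'm)"
  define \<psi> where "\<psi> z = B * (max 0 (1 - u z))\<^sup>2" for z
  define m where "m z = 4 * B * max 0 (1 - u z)" for z
  define G where "G z = ((- m z * p) *\<^sub>R (fst z - fst x), (- m z * q) *\<^sub>R (snd z - snd x))" for z
  have u0: "u z \<ge> 0" for z using pq by (simp add: u_def)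
  have cu: "continuous_on UNIV u" unfolding u_def by (intro continuous_intros)
  have cm: "continuous_on UNIV m" unfolding m_def by (intro continuous_intros cu)
  have cG: "continuous_on UNIV G" unfolding G_def by (intro continuous_intros cm)
  have m: "0 \<le> m z" "m z \<le> 4 * B" for z
    using B u0[of z] mult_left_mono[of "max 0 (1 - u z)" 1 B] by (auto simp: m_def)
  have m0: "m z = 0" if "u z \<ge> 1" for z using that by (simp add: m_def)
  have deriv: "(\<psi> has_derivative (\<lambda>h. G z \<bullet> h)) (at z)" for z
  proof -
    have "(u has_derivative (\<lambda>h. 2 * p * ((fst z - fst x) \<bullet> fst h) + 2 * q * ((snd z - snd x) \<bullet> snd h))) (at z)"
      unfolding u_def by (auto intro!: derivative_eq_intros simp: inner_commute algebra_simps)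
    then have "((\<lambda>z. 1 - u z) has_derivative
        (\<lambda>h. - (2 * p * ((fst z - fst x) \<bullet> fst h) + 2 * q * ((snd z - snd x) \<bullet> snd h)))) (at z)"
      by (auto intro!: derivative_eq_intros)
    from has_derivative_mult_right[OF has_derivative_compose[OF this
        has_field_derivative_max_0_square[unfolded has_field_derivative_def]], of B]
    show ?thesis unfolding \<psi>_def
      by (rule has_derivative_eq_rhs) (auto simp: fun_eq_iff G_def m_def inner_prod_def algebra_simps)
  qed
  have fstG: "(norm (fst (G z)))\<^sup>2 \<le> 16 * B\<^sup>2 * p" and sndG: "(norm (snd (G z)))\<^sup>2 \<le> 16 * B\<^sup>2 * q" for z
  proof -
    have *: "(norm ((- m z * r) *\<^sub>R w))\<^sup>2 \<le> 16 * B\<^sup>2 * r" if "r \<ge> 0" "u z < 1 \<Longrightarrow> r * (norm w)\<^sup>2 \<le> 1"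
      for r and w :: "real ^ 'k"
    proof (cases "u z < 1")
      case True
      have "(norm ((- m z * r) *\<^sub>R w))\<^sup>2 = (m z)\<^sup>2 * r * (r * (norm w)\<^sup>2)"
        by (simp add: power2_eq_square)
      also have "\<dots> \<le> (m z)\<^sup>2 * r * 1"
        using that True by (intro mult_left_mono) auto
      also have "\<dots> \<le> (4 * B)\<^sup>2 * r * 1"
        using that m[of z] by (intro mult_right_mono power_mono) auto
      finally show ?thesis by (simp add: power2_eq_square)
    qed (use m0[of z] that(1) in simp)
    have "p * (norm (fst z - fst x))\<^sup>2 \<le> u z" "q * (norm (snd z - snd x))\<^sup>2 \<le> u z"
      using pq by (auto simp: u_def dot_square_norm)
    then show "(norm (fst (G z)))\<^sup>2 \<le> 16 * B\<^sup>2 * p" "(norm (snd (G z)))\<^sup>2 \<le> 16 * B\<^sup>2 * q"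
      using *[of p "fst z - fst x"] *[of q "snd z - snd x"] pq by (auto simp: G_def)
  qed
  have "W1_infinity \<psi> G"
  proof (rule W1_infinity_C1[OF deriv cG])
    show "norm (G z) \<le> sqrt (16 * B\<^sup>2 * p + 16 * B\<^sup>2 * q)" for z
      using fstG[of z] sndG[of z] unfolding norm_prod_def by (intro real_sqrt_le_mono add_mono)
    show "\<bar>\<psi> z\<bar> \<le> B" for z
      using B u0[of z] mult_left_mono[OF power_mono[of "max 0 (1 - u z)" 1 2], of B]
      by (simp add: \<psi>_def abs_mult)
  qed
  moreover have "AE z in lebesgue. c1 (fst z) * (norm (fst (G z)))\<^sup>2 + c2 (fst z) * (norm (snd (G z)))\<^sup>2 \<le> 1"
    using AE_fst_neq_0
  proof eventually_elim
    case (elim z)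
    show ?case
    proof (cases "u z < 1")
      case True
      have "c1 (fst z) * (norm (fst (G z)))\<^sup>2 + c2 (fst z) * (norm (snd (G z)))\<^sup>2
          \<le> c1 (fst z) * (16 * B\<^sup>2 * p) + c2 (fst z) * (16 * B\<^sup>2 * q)"
        using elim c fstG sndG by (intro add_mono mult_left_mono) auto
      also have "\<dots> \<le> 1" using le[OF elim, of "snd z"] True by (simp add: u_def dot_square_norm)
      finally show ?thesis .
    next
      case False
      then show ?thesis using m0[of z] by (simp add: G_def)
    qed
  qed
  moreover have "continuous_on UNIV \<psi>" unfolding \<psi>_def by (intro continuous_intros cu)
  ultimately have "admissible c1 c2 \<psi>" unfolding admissible_def by blast
  then have "ereal (\<psi> x - \<psi> y) \<le> riem_dist c1 c2 x y"
    unfolding riem_dist_admissible by (intro Sup_upper) auto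
  moreover have "\<psi> x = B" "\<psi> y = 0" using y by (auto simp: \<psi>_def u_def dot_square_norm)
  ultimately show ?thesis by simp
qed

lemma grusin_coeffD:
  assumes "grusin_coeff \<delta> \<delta>' c"
  obtains C where "C > 0" "\<And>x. x \<noteq> 0 \<Longrightarrow> c x \<le> C * (bipow \<delta> \<delta>' (norm x))\<^sup>2"
    "\<And>x. x \<noteq> 0 \<Longrightarrow> (bipow \<delta> \<delta>' (norm x))\<^sup>2 \<le> C * c x" "\<And>x. x \<noteq> 0 \<Longrightarrow> c x > 0"
proof -
  obtain a a' where a: "a > 0" "a' > 0"
    "\<And>x. x \<noteq> 0 \<Longrightarrow> a * c x \<le> bipow (2 * \<delta>) (2 * \<delta>') (norm x) \<and> bipow (2 * \<delta>) (2 * \<delta>') (norm x) \<le> a' * c x"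
    using assms by (auto simp: grusin_coeff_def comparable_on_def)
  have pos: "\<And>x. x \<noteq> 0 \<Longrightarrow> c x > 0" using assms by (auto simp: grusin_coeff_def)
  have sq: "bipow (2 * \<delta>) (2 * \<delta>') (norm x) = (bipow \<delta> \<delta>' (norm x))\<^sup>2" if "x \<noteq> 0" for x :: "real ^ 'a"
    using that by (simp add: bipow_power)
  show ?thesis
  proof (rule that[of "max (1 / a) a'"])
    fix x :: "real ^ 'a" assume x: "x \<noteq> 0"
    have "a * c x \<le> (bipow \<delta> \<delta>' (norm x))\<^sup>2"
      using a(3)[OF x] unfolding sq[OF x] by blast
    then have "c x \<le> 1 / a * (bipow \<delta> \<delta>' (norm x))\<^sup>2"
      using a(1) by (simp add: field_simps)
    also have "\<dots> \<le> max (1 / a) a' * (bipow \<delta> \<delta>' (norm x))\<^sup>2" by (intro mult_right_mono) auto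
    finally show "c x \<le> max (1 / a) a' * (bipow \<delta> \<delta>' (norm x))\<^sup>2" .
    have "(bipow \<delta> \<delta>' (norm x))\<^sup>2 \<le> a' * c x" using a(3)[OF x] by (simp add: sq[OF x])
    also have "\<dots> \<le> max (1 / a) a' * c x" using pos[OF x] by (intro mult_right_mono) auto
    finally show "(bipow \<delta> \<delta>' (norm x))\<^sup>2 \<le> max (1 / a) a' * c x" .
  qed (use a pos in \<open>auto simp: max_def\<close>)
qed

section \<open>Scales of the model geometry and their inverses\<close>

locale grusin_exponents =
  fixes \<delta>1 \<delta>1' \<delta>2 \<delta>2' :: real
  assumes \<delta>: "0 \<le> \<delta>1" "\<delta>1 < 1" "0 \<le> \<delta>1'" "\<delta>1' < 1" "0 \<le> \<delta>2" "0 \<le> \<delta>2'"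
begin

definition "b1 = bipow \<delta>1 \<delta>1'"
definition "b2 = bipow \<delta>2 \<delta>2'"
text \<open>Up to constants, the cost of going from x_1 = 0 to |x_1| = a; \<open>Ninv r\<close> is
  the height reached at cost r.\<close>

definition "N = bipow (1 - \<delta>1) (1 - \<delta>1')"
definition "Ninv = bipow (1 / (1 - \<delta>1)) (1 / (1 - \<delta>1'))"
text \<open>The x_2-displacement which, made at height a, costs as much as reaching that height: P a
  / b2 a = N a. Thus \<open>Pinv t\<close> balances climbing against moving by t.\<close>

definition "P = bipow (1 + \<delta>2 - \<delta>1) (1 + \<delta>2' - \<delta>1')"
definition "Pinv = bipow (1 / (1 + \<delta>2 - \<delta>1)) (1 / (1 + \<delta>2' - \<delta>1'))"
text \<open>A common scaling factor for both weights; the sum of the two exponents dominates each of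
  them.\<close>

definition "L l = l powr (max \<delta>1 \<delta>1' + max \<delta>2 \<delta>2')" for l :: real

lemma b_pos: "a > 0 \<Longrightarrow> b1 a > 0" "a > 0 \<Longrightarrow> b2 a > 0"
  by (simp_all add: b1_def b2_def bipow_pos)

lemma b_nonneg: "b1 a \<ge> 0" "b2 a \<ge> 0"
  by (simp_all add: b1_def b2_def bipow_nonneg)

lemma b_mono: "0 \<le> a \<Longrightarrow> a \<le> b \<Longrightarrow> b1 a \<le> b1 b" "0 \<le> a \<Longrightarrow> a \<le> b \<Longrightarrow> b2 a \<le> b2 b"
  using \<delta> by (simp_all add: b1_def b2_def bipow_mono)

lemma L_ge_1: "l \<ge> 1 \<Longrightarrow> L l \<ge> 1"
  using \<delta> by (simp add: L_def ge_one_powr_ge_zero)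

lemma b_scale:
  assumes "l \<ge> 1" "a \<ge> 0"
  shows "b1 (l * a) \<le> L l * b1 a" "b2 (l * a) \<le> L l * b2 a"
proof -
  have "b1 (l * a) \<le> L l * b1 a \<and> b2 (l * a) \<le> L l * b2 a"
  proof (cases "a = 0")
    case True
    then show ?thesis
      using L_ge_1[OF assms(1)] b_nonneg[of 0] mult_right_mono[of 1 "L l"] by auto
  next
    case False
    then have a: "a > 0" using assms by simp
    have "b1 (l * a) \<le> l powr max \<delta>1 \<delta>1' * b1 a" "b2 (l * a) \<le> l powr max \<delta>2 \<delta>2' * b2 a"
      using bipow_scale_upper[OF assms(1) a] by (auto simp: b1_def b2_def)
    moreover have "l powr max \<delta>1 \<delta>1' \<le> L l" "l powr max \<delta>2 \<delta>2' \<le> L l"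
      using \<delta> assms by (auto simp: L_def intro!: powr_mono)
    ultimately show ?thesis
      using b_nonneg by (meson mult_right_mono order_trans)
  qed
  then show "b1 (l * a) \<le> L l * b1 a" "b2 (l * a) \<le> L l * b2 a" by auto
qed

lemma N_eq: "a \<ge> 0 \<Longrightarrow> N a = a / b1 a"
  using \<delta> bipow_divide[of a 1 1 \<delta>1 \<delta>1'] by (cases "a = 0") (auto simp: N_def b1_def bipow_zero bipow_one)

lemma P_eq: "a \<ge> 0 \<Longrightarrow> P a = N a * b2 a"
  using \<delta> bipow_mult[of a "1 - \<delta>1" "1 - \<delta>1'" \<delta>2 \<delta>2']
  by (cases "a = 0") (auto simp: N_def b2_def P_def bipow_zero algebra_simps)

lemma N_nonneg: "N a \<ge> 0" and Ninv_nonneg: "Ninv a \<ge> 0" and Pinv_nonneg: "Pinv a \<ge> 0"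
  by (simp_all add: N_def Ninv_def Pinv_def bipow_nonneg)

lemma Ninv_pos: "a > 0 \<Longrightarrow> Ninv a > 0" and Pinv_pos: "a > 0 \<Longrightarrow> Pinv a > 0"
  by (simp_all add: N_def Ninv_def Pinv_def bipow_pos)

lemma N_mono: "0 \<le> a \<Longrightarrow> 0 \<le> b \<Longrightarrow> N a \<le> N b \<longleftrightarrow> a \<le> b"
  and P_mono: "0 \<le> a \<Longrightarrow> 0 \<le> b \<Longrightarrow> P a \<le> P b \<longleftrightarrow> a \<le> b"
  using \<delta> by (simp_all add: N_def P_def bipow_le_iff)

lemma N_Ninv: "a \<ge> 0 \<Longrightarrow> N (Ninv a) = a" and P_Pinv: "a \<ge> 0 \<Longrightarrow> P (Pinv a) = a"
  using \<delta> by (cases "a = 0"; simp add: N_def Ninv_def P_def Pinv_def bipow_zero bipow_comp bipow_one)+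

lemma Ninv_le_iff: "0 \<le> a \<Longrightarrow> 0 \<le> r \<Longrightarrow> Ninv r \<le> a \<longleftrightarrow> r \<le> N a"
  using N_mono[of "Ninv r" a] Ninv_nonneg N_Ninv by simp

lemma Pinv_le_iff: "0 \<le> a \<Longrightarrow> 0 \<le> r \<Longrightarrow> Pinv r \<le> a \<longleftrightarrow> r \<le> P a"
  using P_mono[of "Pinv r" a] Pinv_nonneg P_Pinv by simp

text \<open>Since b2 (Pinv t) = t^\<gamma> in the two-regime sense, the second case is t / b2 (Pinv
  t), and t \<le> P s holds exactly when Pinv t \<le> s. So both cases are the cost of moving by t
  at the height max s (Pinv t).\<close>

lemma Delta_fun_eq:
  "Delta_fun \<delta>1 \<delta>1' \<delta>2 \<delta>2' x y = norm (snd x - snd y) / b2 (max (norm (fst x) + norm (fst y)) (Pinv (norm (snd x - snd y))))"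
proof -
  define s where "s = norm (fst x) + norm (fst y)"
  define t where "t = norm (snd x - snd y)"
  have st: "s \<ge> 0" "t \<ge> 0" by (auto simp: s_def t_def)
  have D: "Delta_fun \<delta>1 \<delta>1' \<delta>2 \<delta>2' x y = (if t \<le> P s then t / b2 s else
      bipow (1 - \<delta>2 / (1 + \<delta>2 - \<delta>1)) (1 - \<delta>2' / (1 + \<delta>2' - \<delta>1')) t)"
    by (simp add: Delta_fun_def Let_def s_def t_def P_def b2_def)
  have "Delta_fun \<delta>1 \<delta>1' \<delta>2 \<delta>2' x y = t / b2 (max s (Pinv t))"
  proof (cases "t \<le> P s")
    case True
    then have "Pinv t \<le> s" using Pinv_le_iff st by simp
    then show ?thesis using True D by (simp add: max_absorb1)
  next
    case False
    then have *: "\<not> Pinv t \<le> s" using Pinv_le_iff st by simp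
    have "P s \<ge> 0" by (simp add: P_def bipow_nonneg)
    then have t: "t > 0" using False by linarith
    have "b2 (Pinv t) = bipow (\<delta>2 / (1 + \<delta>2 - \<delta>1)) (\<delta>2' / (1 + \<delta>2' - \<delta>1')) t"
      using t \<delta> by (simp add: b2_def Pinv_def bipow_comp)
    then have "t / b2 (Pinv t) = bipow (1 - \<delta>2 / (1 + \<delta>2 - \<delta>1)) (1 - \<delta>2' / (1 + \<delta>2' - \<delta>1')) t"
      using bipow_divide[OF t, of 1 1] bipow_one[OF t] by simp
    then show ?thesis using False D * by (simp add: max_def)
  qed
  then show ?thesis by (simp add: s_def t_def)
qed

lemma D_fun_eq:
  "D_fun \<delta>1 \<delta>1' \<delta>2 \<delta>2' x y = norm (fst x - fst y) / b1 (norm (fst x) + norm (fst y))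
     + norm (snd x - snd y) / b2 (max (norm (fst x) + norm (fst y)) (Pinv (norm (snd x - snd y))))"
  by (simp add: D_fun_def Delta_fun_eq b1_def)

end

locale grusin = grusin_exponents +
  fixes c1 c2 :: "real ^ 'n \<Rightarrow> real"
  assumes c1: "grusin_coeff \<delta>1 \<delta>1' c1" and c2: "grusin_coeff \<delta>2 \<delta>2' c2"
begin

lemma coeff_bounds:
  obtains C where "C > 0"
    "\<And>x. x \<noteq> 0 \<Longrightarrow> c1 x \<le> C * (b1 (norm x))\<^sup>2" "\<And>x. x \<noteq> 0 \<Longrightarrow> c2 x \<le> C * (b2 (norm x))\<^sup>2"
    "\<And>x. x \<noteq> 0 \<Longrightarrow> (b1 (norm x))\<^sup>2 \<le> C * c1 x" "\<And>x. x \<noteq> 0 \<Longrightarrow> (b2 (norm x))\<^sup>2 \<le> C * c2 x"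
proof -
  obtain C1 where C1: "C1 > 0" "\<And>x. x \<noteq> 0 \<Longrightarrow> c1 x \<le> C1 * (b1 (norm x))\<^sup>2"
    "\<And>x. x \<noteq> 0 \<Longrightarrow> (b1 (norm x))\<^sup>2 \<le> C1 * c1 x" "\<And>x. x \<noteq> 0 \<Longrightarrow> c1 x > 0"
    using grusin_coeffD[OF c1] unfolding b1_def by metis
  obtain C2 where C2: "C2 > 0" "\<And>x. x \<noteq> 0 \<Longrightarrow> c2 x \<le> C2 * (b2 (norm x))\<^sup>2"
    "\<And>x. x \<noteq> 0 \<Longrightarrow> (b2 (norm x))\<^sup>2 \<le> C2 * c2 x" "\<And>x. x \<noteq> 0 \<Longrightarrow> c2 x > 0"
    using grusin_coeffD[OF c2] unfolding b2_def by metis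
  have le: "u \<le> max C1 C2 * w" if "u \<le> C1 * w \<or> u \<le> C2 * w" "w \<ge> 0" for u w
    using that mult_right_mono[of C1 "max C1 C2" w] mult_right_mono[of C2 "max C1 C2" w] by auto
  show ?thesis
    using C1 C2 by (intro that[of "max C1 C2"]) (auto intro!: le simp: less_imp_le)
qed

lemma coeff_pos: "x \<noteq> 0 \<Longrightarrow> c1 x > 0" "x \<noteq> 0 \<Longrightarrow> c2 x > 0"
  using c1 c2 by (auto simp: grusin_coeff_def)

text \<open>Each summand of D is bounded separately by one paraboloid. For the first it depends on
  x_1 only and has width l, so |z_1| \<le> 2 s on its support. For the second the widths are R in
  x_1 and t in x_2, where R = max s (Pinv t), so |z_1| \<le> 2 R.\<close>

lemma D_fun_le_riem_dist:
  obtains K where "K > 0"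
    "\<And>x y :: (real ^ 'n) \<times> (real ^ 'm). ereal (D_fun \<delta>1 \<delta>1' \<delta>2 \<delta>2' x y) \<le> ereal K * riem_dist c1 c2 x y"
proof -
  obtain C where C: "C > 0"
    "\<And>x. x \<noteq> 0 \<Longrightarrow> c1 x \<le> C * (b1 (norm x))\<^sup>2" "\<And>x. x \<noteq> 0 \<Longrightarrow> c2 x \<le> C * (b2 (norm x))\<^sup>2"
    by (rule coeff_bounds) blast
  \<comment> \<open>The constraint evaluates to 16 \<kappa>^2 C (u + v) with u \<le> 4 from the
    x_1-direction and v \<le> 1 from the x_2-direction, whence 80 = 16 * 5.\<close>
  define \<kappa> where "\<kappa> = 1 / sqrt (80 * C)"
  have \<kappa>: "\<kappa> > 0" "\<kappa>\<^sup>2 * (80 * C) = 1"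
    using C(1) by (auto simp: \<kappa>_def power_divide)
  have \<kappa>C: "16 * \<kappa>\<^sup>2 * C * (u + v) \<le> 1" if "u \<le> 4" "v \<le> 1" for u v
    using \<kappa> mult_left_mono[of "u + v" 5 "16 * \<kappa>\<^sup>2 * C"] C(1) that by (simp add: mult_ac)
  have c_pos: "z \<noteq> 0 \<Longrightarrow> c1 z \<ge> 0" "z \<noteq> 0 \<Longrightarrow> c2 z \<ge> 0" for z
    using coeff_pos[of z] by auto
  define K where "K = 2 * L 2 / \<kappa>"
  have L2: "L 2 \<ge> 1" using L_ge_1[of 2] by simp
  have "ereal (D_fun \<delta>1 \<delta>1' \<delta>2 \<delta>2' x y) \<le> ereal K * riem_dist c1 c2 x y"
    for x y :: "(real ^ 'n) \<times> (real ^ 'm)"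
  proof -
    define s where "s = norm (fst x) + norm (fst y)"
    define l where "l = norm (fst x - fst y)"
    define t where "t = norm (snd x - snd y)"
    define R where "R = max s (Pinv t)"
    have ls: "l \<le> s" unfolding l_def s_def by (rule norm_triangle_ineq4)
    have "ereal (\<kappa> * (l / b1 (2 * s))) \<le> riem_dist c1 c2 x y \<and> ereal (\<kappa> * (t / b2 (2 * R))) \<le> riem_dist c1 c2 x y"
    proof
      \<comment> \<open>Covers l = 0 and t = 0, where the widths of the paraboloids would
        degenerate.\<close>
      have nonneg: "ereal 0 \<le> riem_dist c1 c2 x y"
      proof -
        have "admissible c1 c2 (\<lambda>_ :: (real ^ 'n) \<times> (real ^ 'm). 0)"
          unfolding admissible_def using W1_infinity_C1[of "\<lambda>_. 0" "\<lambda>_. 0" 0 0]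
          by (auto intro!: exI[of _ "\<lambda>_. 0"])
        then show ?thesis unfolding riem_dist_admissible by (intro Sup_upper) force
      qed
      show "ereal (\<kappa> * (l / b1 (2 * s))) \<le> riem_dist c1 c2 x y"
      proof (cases "l = 0")
        case False
        then have l: "l > 0" by (simp add: l_def)
        let ?B = "\<kappa> * (l / b1 (2 * s))"
        have b: "b1 (2 * s) > 0" using b_pos l ls by simp
        show ?thesis
        proof (rule riem_dist_ge[where p = "1 / l\<^sup>2" and q = 0])
          fix z1 :: "real ^ 'n" and z2 :: "real ^ 'm"
          assume z: "z1 \<noteq> 0" "1 / l\<^sup>2 * (norm (z1 - fst x))\<^sup>2 + 0 * (norm (z2 - snd x))\<^sup>2 < 1"
          then have "(norm (z1 - fst x))\<^sup>2 < l\<^sup>2" using l by simp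
          then have "norm (z1 - fst x) < l" using l by (simp add: power_less_imp_less_base)
          moreover have "norm z1 \<le> norm (z1 - fst x) + norm (fst x)" by norm
          ultimately have "norm z1 \<le> 2 * norm (fst x) + norm (fst y)" using ls unfolding s_def by linarith
          also have "\<dots> \<le> 2 * s" by (simp add: s_def)
          finally have "norm z1 \<le> 2 * s" .
          then have "b1 (norm z1) \<le> b1 (2 * s)" by (intro b_mono) auto
          then have "(b1 (norm z1))\<^sup>2 \<le> (b1 (2 * s))\<^sup>2" by (intro power_mono b_nonneg)
          then have "c1 z1 \<le> C * (b1 (2 * s))\<^sup>2" using C(2)[OF z(1)] C(1)
            by (meson mult_le_cancel_left_pos order_trans)
          then have "c1 z1 * (16 * ?B\<^sup>2 * (1 / l\<^sup>2)) \<le> C * (b1 (2 * s))\<^sup>2 * (16 * ?B\<^sup>2 * (1 / l\<^sup>2))"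
            by (intro mult_right_mono) auto
          also have "\<dots> = 16 * \<kappa>\<^sup>2 * C * (1 + 0)" using l b by (simp add: field_simps)
          also have "\<dots> \<le> 1" by (rule \<kappa>C) auto
          finally show "c1 z1 * (16 * ?B\<^sup>2 * (1 / l\<^sup>2)) + c2 z1 * (16 * ?B\<^sup>2 * 0) \<le> 1" by simp
        next
          show "0 \<le> ?B" using \<kappa> l b by simp
        qed (use l c_pos in \<open>auto simp: l_def norm_minus_commute\<close>)
      qed (use nonneg in simp)
      show "ereal (\<kappa> * (t / b2 (2 * R))) \<le> riem_dist c1 c2 x y"
      proof (cases "t = 0")
        case False
        then have t: "t > 0" by (simp add: t_def)
        have R: "R > 0" using Pinv_pos[OF t] by (simp add: R_def)
        let ?B = "\<kappa> * (t / b2 (2 * R))"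
        have b: "b1 (2 * R) > 0" "b2 (2 * R) > 0" using b_pos R by auto
        have "Pinv t \<le> R" by (simp add: R_def)
        \<comment> \<open>Written out, this says that the x_1-part of the constraint is at most 4
          times the x_2-part; it is the reason for the cut-off at height
          \<open>Pinv t\<close>.\<close>
        then have "t \<le> P (2 * R)" using Pinv_le_iff[of "2 * R" t] t R by simp
        then have "t * b1 (2 * R) \<le> 2 * R * b2 (2 * R)"
          using R b by (simp add: P_eq N_eq field_simps)
        then have tR: "(b1 (2 * R) * t / (R * b2 (2 * R)))\<^sup>2 \<le> 2\<^sup>2"
          using R b t by (intro power_mono) (auto simp: field_simps)
        show ?thesis
        proof (rule riem_dist_ge[where p = "1 / R\<^sup>2" and q = "1 / t\<^sup>2"])
          fix z1 :: "real ^ 'n" and z2 :: "real ^ 'm"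
          assume z: "z1 \<noteq> 0" "1 / R\<^sup>2 * (norm (z1 - fst x))\<^sup>2 + 1 / t\<^sup>2 * (norm (z2 - snd x))\<^sup>2 < 1"
          have "0 \<le> 1 / t\<^sup>2 * (norm (z2 - snd x))\<^sup>2" by simp
          then have "1 / R\<^sup>2 * (norm (z1 - fst x))\<^sup>2 < 1" using z(2) by linarith
          then have "(norm (z1 - fst x))\<^sup>2 < R\<^sup>2" using R by simp
          then have "norm (z1 - fst x) < R" using R by (simp add: power_less_imp_less_base)
          moreover have "norm z1 \<le> norm (z1 - fst x) + norm (fst x)" by norm
          moreover have "norm (fst x) \<le> R" by (simp add: R_def s_def le_max_iff_disj)
          ultimately have "norm z1 \<le> 2 * R" by simp
          then have "b1 (norm z1) \<le> b1 (2 * R)" "b2 (norm z1) \<le> b2 (2 * R)" by (intro b_mono; simp)+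
          then have "(b1 (norm z1))\<^sup>2 \<le> (b1 (2 * R))\<^sup>2" "(b2 (norm z1))\<^sup>2 \<le> (b2 (2 * R))\<^sup>2"
            by (intro power_mono b_nonneg; simp)+
          then have "c1 z1 \<le> C * (b1 (2 * R))\<^sup>2" "c2 z1 \<le> C * (b2 (2 * R))\<^sup>2"
            using C(2,3)[OF z(1)] C(1) by (meson mult_le_cancel_left_pos order_trans)+
          then have "c1 z1 * (16 * ?B\<^sup>2 * (1 / R\<^sup>2)) + c2 z1 * (16 * ?B\<^sup>2 * (1 / t\<^sup>2))
              \<le> C * (b1 (2 * R))\<^sup>2 * (16 * ?B\<^sup>2 * (1 / R\<^sup>2)) + C * (b2 (2 * R))\<^sup>2 * (16 * ?B\<^sup>2 * (1 / t\<^sup>2))"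
            by (intro add_mono mult_right_mono) auto
          also have "\<dots> = 16 * \<kappa>\<^sup>2 * C * ((b1 (2 * R) * t / (R * b2 (2 * R)))\<^sup>2 + 1)"
            using t R b by (simp add: field_simps)
          also have "\<dots> \<le> 1" using tR by (intro \<kappa>C) auto
          finally show "c1 z1 * (16 * ?B\<^sup>2 * (1 / R\<^sup>2)) + c2 z1 * (16 * ?B\<^sup>2 * (1 / t\<^sup>2)) \<le> 1" .
        next
          have "1 / t\<^sup>2 * (norm (snd y - snd x))\<^sup>2 = 1" using t by (simp add: t_def norm_minus_commute)
          moreover have "0 \<le> 1 / R\<^sup>2 * (norm (fst y - fst x))\<^sup>2" by simp
          ultimately show "1 \<le> 1 / R\<^sup>2 * (norm (fst y - fst x))\<^sup>2 + 1 / t\<^sup>2 * (norm (snd y - snd x))\<^sup>2"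
            by linarith
        next
          show "0 \<le> ?B" using \<kappa> t b by simp
        qed (use c_pos in auto)
      qed (use nonneg in simp)
    qed
    \<comment> \<open>The weights were evaluated at twice the natural scale; doubling returns to s
      and R at the price of \<open>L 2\<close>.\<close>
    moreover have *: "\<kappa> * (l / b1 (2 * s)) \<ge> \<kappa> / L 2 * (l / b1 s)" "\<kappa> * (t / b2 (2 * R)) \<ge> \<kappa> / L 2 * (t / b2 R)"
    proof -
      have st: "s \<ge> 0" "R \<ge> 0" "t \<ge> 0" "l \<ge> 0" by (auto simp: s_def R_def t_def l_def le_max_iff_disj)
      have div: "\<kappa> * (u / w') \<ge> \<kappa> / L 2 * (u / w)" if "0 \<le> u" "w' \<le> L 2 * w" "w' > 0 \<or> u = 0" for u w w'
      proof (cases "u = 0")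
        case False
        then have w: "w' > 0" using that by auto
        then have "w > 0" using that L2 by (smt (verit) mult_nonneg_nonpos)
        have "u / (L 2 * w) \<le> u / w'"
          using that w by (intro divide_left_mono) auto
        then show ?thesis using \<kappa>(1) mult_left_mono[of "u / (L 2 * w)" "u / w'" \<kappa>] by simp
      qed simp
      show "\<kappa> * (l / b1 (2 * s)) \<ge> \<kappa> / L 2 * (l / b1 s)"
        using st b_scale[of 2 s] ls b_pos[of "2 * s"] by (intro div) (auto simp: less_le)
      have "R > 0 \<or> t = 0" using Pinv_pos[of t] st by (auto simp: R_def less_max_iff_disj)
      then show "\<kappa> * (t / b2 (2 * R)) \<ge> \<kappa> / L 2 * (t / b2 R)"
        using st b_scale[of 2 R] b_pos[of "2 * R"] by (intro div) auto
    qed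
    ultimately have "ereal (\<kappa> / L 2 * (l / b1 s)) \<le> riem_dist c1 c2 x y"
      "ereal (\<kappa> / L 2 * (t / b2 R)) \<le> riem_dist c1 c2 x y"
      by (meson ereal_less_eq(3) order_trans)+
    \<comment> \<open>Both summands lie below the same distance, so their sum lies below twice it;
      hence the 2 in \<open>K\<close>.\<close>
    then have m: "ereal (max (\<kappa> / L 2 * (l / b1 s)) (\<kappa> / L 2 * (t / b2 R))) \<le> riem_dist c1 c2 x y"
      by (simp add: max_def)
    have "D_fun \<delta>1 \<delta>1' \<delta>2 \<delta>2' x y = l / b1 s + t / b2 R"
      by (simp add: D_fun_eq l_def s_def t_def R_def)
    also have "\<dots> = (\<kappa> / L 2 * (l / b1 s) + \<kappa> / L 2 * (t / b2 R)) * (L 2 / \<kappa>)"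
      using \<kappa>(1) L2 by (simp add: field_simps)
    also have "\<dots> \<le> (2 * max (\<kappa> / L 2 * (l / b1 s)) (\<kappa> / L 2 * (t / b2 R))) * (L 2 / \<kappa>)"
      using \<kappa>(1) L2 by (intro mult_right_mono) auto
    also have "\<dots> = K * max (\<kappa> / L 2 * (l / b1 s)) (\<kappa> / L 2 * (t / b2 R))" by (simp add: K_def)
    finally have "ereal (D_fun \<delta>1 \<delta>1' \<delta>2 \<delta>2' x y) \<le> ereal K * ereal (max (\<kappa> / L 2 * (l / b1 s)) (\<kappa> / L 2 * (t / b2 R)))"
      by (simp only: times_ereal.simps ereal_less_eq)
    also have "\<dots> \<le> ereal K * riem_dist c1 c2 x y"
      using \<kappa>(1) L2 by (intro ereal_mult_left_mono m) (simp add: K_def)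
    finally show ?thesis .
  qed
  then show ?thesis using \<kappa>(1) L2 by (intro that[of K]) (auto simp: K_def)
qed

section \<open>Increments of admissible functions away from x_1 = 0\<close>

text \<open>The tube of radius |x_1|/4 around the segment stays in |z_1| \<ge> |x_1|/4, where
  monotonicity and scaling by 4 bound the weights from below by those at x_1. The constraint then
  bounds each part of the gradient by sqrt C times \<open>L 4\<close> over its weight.\<close>

lemma admissible_segment:
  obtains K where "K > 0"
    "\<And>(\<psi> :: (real ^ 'n) \<times> (real ^ 'm) \<Rightarrow> real) x v. admissible c1 c2 \<psi> \<Longrightarrow> fst x \<noteq> 0 \<Longrightarrow> norm (fst v) \<le> norm (fst x) / 2 \<Longrightarrow>
       \<bar>\<psi> (x + v) - \<psi> x\<bar> \<le> K * (norm (fst v) / b1 (norm (fst x)) + norm (snd v) / b2 (norm (fst x)))"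
proof -
  obtain C where C: "C > 0"
    "\<And>x. x \<noteq> 0 \<Longrightarrow> (b1 (norm x))\<^sup>2 \<le> C * c1 x" "\<And>x. x \<noteq> 0 \<Longrightarrow> (b2 (norm x))\<^sup>2 \<le> C * c2 x"
    by (rule coeff_bounds) blast
  define K where "K = sqrt C * L 4"
  have L4: "L 4 \<ge> 1" using L_ge_1[of 4] by simp
  have "\<bar>\<psi> (x + v) - \<psi> x\<bar> \<le> K * (norm (fst v) / b1 (norm (fst x)) + norm (snd v) / b2 (norm (fst x)))"
    if adm: "admissible c1 c2 \<psi>" and x: "fst x \<noteq> 0" and v: "norm (fst v) \<le> norm (fst x) / 2"
    for \<psi> :: "(real ^ 'n) \<times> (real ^ 'm) \<Rightarrow> real" and x v
  proof -
    obtain G where G: "W1_infinity \<psi> G" and cont: "continuous_on UNIV \<psi>"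
      and le: "AE x in lebesgue. c1 (fst x) * (norm (fst (G x)))\<^sup>2 + c2 (fst x) * (norm (snd (G x)))\<^sup>2 \<le> 1"
      using adm by (auto simp: admissible_def)
    have xp: "norm (fst x) > 0" using x by simp
    show ?thesis
    proof (rule W1_infinity_segment[OF G cont, of "norm (fst x) / 4"])
      show "AE z in lebesgue. \<forall>t\<in>{0..1}. norm (z - (x + t *\<^sub>R v)) < norm (fst x) / 4 \<longrightarrow>
          \<bar>G z \<bullet> v\<bar> \<le> K * (norm (fst v) / b1 (norm (fst x)) + norm (snd v) / b2 (norm (fst x)))"
        using le
      proof eventually_elim
        case (elim z)
        show ?case
        proof (intro ballI impI)
          fix t :: real assume t: "t \<in> {0..1}" and z: "norm (z - (x + t *\<^sub>R v)) < norm (fst x) / 4"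
          have "norm (fst (z - (x + t *\<^sub>R v))) < norm (fst x) / 4"
            using z norm_fst_le[of "fst (z - (x + t *\<^sub>R v))" "snd (z - (x + t *\<^sub>R v))"]
            unfolding prod.collapse by linarith
          moreover have "norm (t *\<^sub>R fst v) \<le> norm (fst x) / 2"
            using t v mult_left_le_one_le[of "norm (fst v)" t] by simp
          moreover have "norm (fst x) \<le> norm (fst z) + norm (fst (z - (x + t *\<^sub>R v))) + norm (t *\<^sub>R fst v)"
            using norm_triangle_ineq[of "fst z" "- fst (z - (x + t *\<^sub>R v)) - t *\<^sub>R fst v"]
              norm_triangle_ineq[of "- fst (z - (x + t *\<^sub>R v))" "- (t *\<^sub>R fst v)"]
            by (simp add: norm_minus_commute)
          ultimately have zx: "norm (fst x) \<le> 4 * norm (fst z)" by linarith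
          then have z0: "fst z \<noteq> 0" using xp by auto
          \<comment> \<open>Stated for an arbitrary weight and vector so that it serves both
            gradient components; each summand of the constraint is at most 1 because the other is
            non-negative.\<close>
          have G1: "norm w \<le> sqrt C * L 4 / b x'"
            if "(b (norm (fst z)))\<^sup>2 \<le> C * c" "c * (norm w)\<^sup>2 \<le> 1" "b x' > 0" "b x' \<le> L 4 * b (norm (fst z))"
            for b :: "real \<Rightarrow> real" and c x' and w :: "'c::real_normed_vector"
          proof -
            have "(b (norm (fst z)) * norm w)\<^sup>2 \<le> C * c * (norm w)\<^sup>2"
              using that by (simp add: power_mult_distrib mult_right_mono)
            also have "\<dots> \<le> C" using that C(1) mult_left_mono[of "c * (norm w)\<^sup>2" 1 C] by (simp add: mult_ac)
            finally have "b (norm (fst z)) * norm w \<le> sqrt C" by (rule real_le_rsqrt)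
            then have "L 4 * (b (norm (fst z)) * norm w) \<le> L 4 * sqrt C" using L4 by simp
            moreover have "b x' * norm w \<le> L 4 * b (norm (fst z)) * norm w"
              using that by (intro mult_right_mono) auto
            ultimately show ?thesis using that(3) by (simp add: field_simps)
          qed
          have pos: "0 \<le> c1 (fst z) * (norm (fst (G z)))\<^sup>2" "0 \<le> c2 (fst z) * (norm (snd (G z)))\<^sup>2"
            using coeff_pos[OF z0] by auto
          have "b1 (norm (fst x)) \<le> b1 (4 * norm (fst z))" "b2 (norm (fst x)) \<le> b2 (4 * norm (fst z))"
            using zx xp by (auto intro!: b_mono)
          then have bx: "b1 (norm (fst x)) \<le> L 4 * b1 (norm (fst z))" "b2 (norm (fst x)) \<le> L 4 * b2 (norm (fst z))"
            using b_scale[of 4 "norm (fst z)"] by auto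
          have "norm (fst (G z)) \<le> sqrt C * L 4 / b1 (norm (fst x))"
            using C(2)[OF z0] elim pos bx b_pos[OF xp] by (intro G1[of b1 "c1 (fst z)"]) auto
          moreover have "norm (snd (G z)) \<le> sqrt C * L 4 / b2 (norm (fst x))"
            using C(3)[OF z0] elim pos bx b_pos[OF xp] by (intro G1[of b2 "c2 (fst z)"]) auto
          moreover have "\<bar>G z \<bullet> v\<bar> \<le> norm (fst (G z)) * norm (fst v) + norm (snd (G z)) * norm (snd v)"
            using Cauchy_Schwarz_ineq2[of "fst (G z)" "fst v"] Cauchy_Schwarz_ineq2[of "snd (G z)" "snd v"]
            by (simp add: inner_prod_def)
          ultimately have "\<bar>G z \<bullet> v\<bar> \<le> sqrt C * L 4 / b1 (norm (fst x)) * norm (fst v)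
              + sqrt C * L 4 / b2 (norm (fst x)) * norm (snd v)"
            by (meson add_mono mult_right_mono norm_ge_zero order_trans)
          then show "\<bar>G z \<bullet> v\<bar> \<le> K * (norm (fst v) / b1 (norm (fst x)) + norm (snd v) / b2 (norm (fst x)))"
            by (simp add: K_def field_simps)
        qed
      qed
    qed (use xp in simp)
  qed
  then show ?thesis using C(1) L4 by (intro that[of K]) (auto simp: K_def)
qed

end

section \<open>Upper bound for the distance\<close>

context grusin
begin

text \<open>A halving step is the longest radial step that \<open>admissible_segment\<close> allows,
  and it costs at most K/2 times N |w|. As N (a/2) \<le> \<theta> N a with \<theta> < 1, this is at
  most M (N |w| - N (|w|/2)), which telescopes; that choice determines M = K / (2 (1 -
  \<theta>)).\<close>

lemma admissible_radial:
  obtains K where "K > 0"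
    "\<And>(\<psi> :: (real ^ 'n) \<times> (real ^ 'm) \<Rightarrow> real) x1 x2. admissible c1 c2 \<psi> \<Longrightarrow> \<bar>\<psi> (0, x2) - \<psi> (x1, x2)\<bar> \<le> K * N (norm x1)"
proof -
  obtain K where K: "K > 0"
    "\<And>(\<psi> :: (real ^ 'n) \<times> (real ^ 'm) \<Rightarrow> real) x v. admissible c1 c2 \<psi> \<Longrightarrow> fst x \<noteq> 0 \<Longrightarrow> norm (fst v) \<le> norm (fst x) / 2 \<Longrightarrow>
       \<bar>\<psi> (x + v) - \<psi> x\<bar> \<le> K * (norm (fst v) / b1 (norm (fst x)) + norm (snd v) / b2 (norm (fst x)))"
    by (rule admissible_segment) blast
  define \<theta> where "\<theta> = 2 powr - min (1 - \<delta>1) (1 - \<delta>1')"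
  have \<theta>: "\<theta> < 1" using \<delta> by (simp add: \<theta>_def powr_less_one)
  have N_half: "N (a / 2) \<le> \<theta> * N a" if "a \<ge> 0" for a
  proof (cases "a = 0")
    case False
    then show ?thesis
      using that bipow_scale_lower[of 2 "a / 2" "1 - \<delta>1" "1 - \<delta>1'"]
      by (simp add: N_def \<theta>_def powr_minus divide_simps mult.commute)
  qed (use \<delta> in \<open>simp add: N_def bipow_zero\<close>)
  define M where "M = K / (2 * (1 - \<theta>))"
  have M: "M > 0" using K \<theta> by (simp add: M_def)
  have "\<bar>\<psi> (0, x2) - \<psi> (x1, x2)\<bar> \<le> M * N (norm x1)" if adm: "admissible c1 c2 \<psi>"
    for \<psi> :: "(real ^ 'n) \<times> (real ^ 'm) \<Rightarrow> real" and x1 x2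
  proof -
    have step: "\<bar>\<psi> (w /\<^sub>R 2, x2) - \<psi> (w, x2)\<bar> \<le> M * (N (norm w) - N (norm w / 2))" for w
    proof (cases "w = 0")
      case False
      have "\<bar>\<psi> ((w, x2) + (- (w /\<^sub>R 2), 0)) - \<psi> (w, x2)\<bar>
          \<le> K * (norm (- (w /\<^sub>R 2)) / b1 (norm w) + norm (0 :: real ^ 'm) / b2 (norm w))"
        using K(2)[OF adm, of "(w, x2)" "(- (w /\<^sub>R 2), 0)"] False by simp
      moreover have "(w, x2) + (- (w /\<^sub>R 2), 0) = (w /\<^sub>R 2, x2)"
      proof -
        have "w /\<^sub>R 2 + w /\<^sub>R 2 = w" by (simp flip: scaleR_add_left)
        then show ?thesis by (metis add_Pair add_diff_cancel_left' add.right_neutral diff_conv_add_uminus)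
      qed
      ultimately have "\<bar>\<psi> (w /\<^sub>R 2, x2) - \<psi> (w, x2)\<bar> \<le> K * (norm (w /\<^sub>R 2) / b1 (norm w))"
        by (simp only: norm_minus_cancel norm_zero div_0 add_0_right)
      also have "\<dots> = K / 2 * N (norm w)" by (simp add: N_eq field_simps)
      finally have "\<bar>\<psi> (w /\<^sub>R 2, x2) - \<psi> (w, x2)\<bar> \<le> K / 2 * N (norm w)" .
      also have "K / 2 * N (norm w) = M * (N (norm w) - \<theta> * N (norm w))"
        using \<theta> by (simp add: M_def field_simps)
      also have "\<dots> \<le> M * (N (norm w) - N (norm w / 2))"
        using N_half[of "norm w"] M by simp
      finally show ?thesis .
    qed simp
    have chain: "\<bar>\<psi> (x1 /\<^sub>R 2 ^ j, x2) - \<psi> (x1, x2)\<bar> \<le> M * (N (norm x1) - N (norm x1 / 2 ^ j))" for j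
    proof (induction j)
      case (Suc j)
      have "\<bar>\<psi> (x1 /\<^sub>R 2 ^ Suc j, x2) - \<psi> (x1 /\<^sub>R 2 ^ j, x2)\<bar>
          \<le> M * (N (norm x1 / 2 ^ j) - N (norm x1 / 2 ^ Suc j))"
        using step[of "x1 /\<^sub>R 2 ^ j"] by (simp add: field_simps)
      then show ?case using Suc by (simp add: right_diff_distrib)
    qed simp
    \<comment> \<open>Only the continuity of \<psi> gives access to its value on x_1 = 0.\<close>
    have "(\<lambda>j. \<psi> (x1 /\<^sub>R 2 ^ j, x2)) \<longlonglongrightarrow> \<psi> (0, x2)"
    proof -
      have "(\<lambda>j. inverse (2 ^ j) :: real) \<longlonglongrightarrow> 0"
        by (rule LIMSEQ_inverse_realpow_zero) simp
      then have "(\<lambda>j. (x1 /\<^sub>R 2 ^ j, x2)) \<longlonglongrightarrow> (0 *\<^sub>R x1, x2)"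
        by (intro tendsto_intros)
      then have lim: "(\<lambda>j. (x1 /\<^sub>R 2 ^ j, x2)) \<longlonglongrightarrow> (0, x2)" by simp
      have "isCont \<psi> (0, x2)"
        using adm by (simp add: admissible_def continuous_on_eq_continuous_at)
      then show ?thesis using lim by (rule isCont_tendsto_compose)
    qed
    then have "(\<lambda>j. \<bar>\<psi> (x1 /\<^sub>R 2 ^ j, x2) - \<psi> (x1, x2)\<bar>) \<longlonglongrightarrow> \<bar>\<psi> (0, x2) - \<psi> (x1, x2)\<bar>"
      by (intro tendsto_intros)
    then show ?thesis
    proof (rule LIMSEQ_le_const2)
      have "M * (N (norm x1) - N (norm x1 / 2 ^ j)) \<le> M * N (norm x1)" for j
        using M N_nonneg by simp
      then show "\<exists>j0. \<forall>j\<ge>j0. \<bar>\<psi> (x1 /\<^sub>R 2 ^ j, x2) - \<psi> (x1, x2)\<bar> \<le> M * N (norm x1)"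
        using chain order_trans by blast
    qed
  qed
  then show ?thesis using M by (intro that[of M]) auto
qed

text \<open>A route is chosen for each configuration and the increments of \<psi> along it are
  added. If t \<le> P s and x_1, y_1 are close, one segment suffices. If they are far apart, x_2 is
  changed first and then x_1 through 0, which also covers points on opposite sides when n = 1. If t
  > P s, the route descends to x_1 = 0, climbs to height Pinv t, changes x_2 there and
  returns.\<close>

lemma riem_dist_le_D_fun:
  obtains K where "K > 0"
    "\<And>x y :: (real ^ 'n) \<times> (real ^ 'm). riem_dist c1 c2 x y \<le> ereal (K * D_fun \<delta>1 \<delta>1' \<delta>2 \<delta>2' x y)"
proof -
  obtain A where A: "A > 0"
    "\<And>(\<psi> :: (real ^ 'n) \<times> (real ^ 'm) \<Rightarrow> real) x v. admissible c1 c2 \<psi> \<Longrightarrow> fst x \<noteq> 0 \<Longrightarrow> norm (fst v) \<le> norm (fst x) / 2 \<Longrightarrow>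
       \<bar>\<psi> (x + v) - \<psi> x\<bar> \<le> A * (norm (fst v) / b1 (norm (fst x)) + norm (snd v) / b2 (norm (fst x)))"
    by (rule admissible_segment) blast
  obtain B where B: "B > 0"
    "\<And>(\<psi> :: (real ^ 'n) \<times> (real ^ 'm) \<Rightarrow> real) x1 x2. admissible c1 c2 \<psi> \<Longrightarrow> \<bar>\<psi> (0, x2) - \<psi> (x1, x2)\<bar> \<le> B * N (norm x1)"
    by (rule admissible_radial) blast
  have L2: "L 2 \<ge> 1" using L_ge_1[of 2] by simp
  \<comment> \<open>The terms pay for the direct segment (A times \<open>L 2\<close>), the detour
    through x_1 = 0 (8 B) and the climb (A + 4 B).\<close>
  define K where "K = A * L 2 + A + 8 * B"
  have K: "K > 0" "A * L 2 \<le> K" "8 * B \<le> K" "A + 4 * B \<le> K"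
    using A(1) B(1) L2 by (auto simp: K_def intro!: add_pos_pos)
  have move2: "\<bar>\<psi> (p, y2) - \<psi> (p, x2)\<bar> \<le> A * (norm (x2 - y2) / b2 (norm p))"
    if "admissible c1 c2 \<psi>" "p \<noteq> 0" for \<psi> :: "(real ^ 'n) \<times> (real ^ 'm) \<Rightarrow> real" and p x2 y2
    using A(2)[OF that(1), of "(p, x2)" "(0, y2 - x2)"] that(2) by (simp add: norm_minus_commute)
  have bound: "\<bar>\<psi> y - \<psi> x\<bar> \<le> K * D_fun \<delta>1 \<delta>1' \<delta>2 \<delta>2' x y"
    if adm: "admissible c1 c2 \<psi>" and xy: "norm (fst y) \<le> norm (fst x)"
    for \<psi> :: "(real ^ 'n) \<times> (real ^ 'm) \<Rightarrow> real" and x y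
  proof -
    obtain x1 x2 y1 y2 where x: "x = (x1, x2)" and y: "y = (y1, y2)" by (metis prod.collapse)
    define s where "s = norm x1 + norm y1"
    define l where "l = norm (x1 - y1)"
    define t where "t = norm (x2 - y2)"
    have st: "s \<ge> 0" "l \<ge> 0" "t \<ge> 0" by (auto simp: s_def l_def t_def)
    have sx: "norm x1 \<le> s" "norm y1 \<le> s" "s \<le> 2 * norm x1" using xy by (auto simp: s_def x y)
    have D: "D_fun \<delta>1 \<delta>1' \<delta>2 \<delta>2' x y = l / b1 s + t / b2 (max s (Pinv t))"
      by (simp add: D_fun_eq x y s_def l_def t_def)
    note rad = B(2)[OF adm]
    have Ns: "N (norm x1) \<le> N s" "N (norm y1) \<le> N s" using sx st by (simp_all add: N_mono)
    have lb: "l / b1 s \<ge> 0" using st b_nonneg by simp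
    show ?thesis
    proof (cases "t \<le> P s")
      case True
      then have R: "max s (Pinv t) = s" using Pinv_le_iff st by (simp add: max_absorb1)
      show ?thesis
      proof (cases "s = 0")
        case True
        then have "x1 = 0" "y1 = 0" using sx by auto
        moreover have "t = 0" using True \<open>t \<le> P s\<close> st \<delta> by (simp add: P_def bipow_zero)
        ultimately have "x = y" by (simp add: x y t_def)
        moreover have "0 \<le> K * D_fun \<delta>1 \<delta>1' \<delta>2 \<delta>2' x y"
          unfolding D using K st b_nonneg
          by (intro mult_nonneg_nonneg add_nonneg_nonneg divide_nonneg_nonneg) auto
        ultimately show ?thesis by simp
      next
        case False
        then have s: "s > 0" using st by simp
        then have x1: "x1 \<noteq> 0" using sx by auto
        have "b1 s \<le> b1 (2 * norm x1)" "b2 s \<le> b2 (2 * norm x1)" using sx st by (auto intro!: b_mono)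
        then have bL: "b1 s \<le> L 2 * b1 (norm x1)" "b2 s \<le> L 2 * b2 (norm x1)"
          using b_scale[of 2 "norm x1"] by auto
        have div: "A * (u / w) \<le> K * (u / w')" if "u \<ge> 0" "w > 0" "w' > 0" "w' \<le> L 2 * w" for u w w' :: real
        proof -
          have "u / w \<le> L 2 * (u / w')"
            using that mult_left_mono[of w' "L 2 * w" u] by (simp add: field_simps)
          then have "A * (u / w) \<le> A * (L 2 * (u / w'))" using A(1) by (intro mult_left_mono) auto
          also have "\<dots> = A * L 2 * (u / w')" by (simp only: mult.assoc)
          also have "\<dots> \<le> K * (u / w')" using K that by (intro mult_right_mono) auto
          finally show ?thesis .
        qed
        have bp: "b1 (norm x1) > 0" "b2 (norm x1) > 0" "b1 s > 0" "b2 s > 0" using b_pos x1 s by auto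
        have t_le: "A * (t / b2 (norm x1)) \<le> K * (t / b2 s)" using div st bp bL by simp
        show ?thesis
        proof (cases "l \<le> norm x1 / 2")
          case True
          have "\<bar>\<psi> y - \<psi> x\<bar> \<le> A * (l / b1 (norm x1) + t / b2 (norm x1))"
            using A(2)[OF adm, of x "y - x"] x1 True
            by (simp add: x y l_def t_def norm_minus_commute)
          also have "\<dots> = A * (l / b1 (norm x1)) + A * (t / b2 (norm x1))" by (simp add: distrib_left)
          also have "\<dots> \<le> K * (l / b1 s) + K * (t / b2 s)"
            using div st bp bL t_le by (intro add_mono) auto
          finally show ?thesis by (simp add: D R distrib_left)
        next
          case False
          \<comment> \<open>Here l > |x_1|/2 \<ge> s/4, so the two radial pieces, together at most 2
            B N s = 2 B s / b1 s, are paid for by the first summand of D.\<close>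
          have "B * N (norm x1) \<le> B * N s" "B * N (norm y1) \<le> B * N s"
            using Ns B(1) by (auto intro!: mult_left_mono)
          then have "\<bar>\<psi> y - \<psi> x\<bar> \<le> B * N s + B * N s + A * (t / b2 (norm x1))"
            using rad[of y2 x1] rad[of y2 y1] move2[OF adm x1, of y2 x2] unfolding x y t_def by linarith
          also have "B * N s + B * N s = 2 * B * s / b1 s" using st by (simp add: N_eq)
          also have "\<dots> \<le> 2 * B * (4 * l) / b1 s"
            using False sx B(1) bp by (intro divide_right_mono mult_left_mono) auto
          also have "\<dots> = 8 * B * (l / b1 s)" by simp
          also have "\<dots> \<le> K * (l / b1 s)" using K lb by (intro mult_right_mono)
          finally show ?thesis using t_le by (simp add: D R distrib_left)
        qed
      qed
    next
      case False
      define R where "R = Pinv t"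
      have R: "s < R" "max s (Pinv t) = R" using False Pinv_le_iff[of s t] st by (auto simp: R_def max_def)
      have Rp: "R > 0" using R st by simp
      \<comment> \<open>The direction is arbitrary, since the route enters and leaves this height
        through x_1 = 0.\<close>
      obtain e :: "real ^ 'n" where "e \<in> Basis" using nonempty_Basis by blast
      then have e: "norm e = 1" by simp
      define p where "p = R *\<^sub>R e"
      have p: "norm p = R" "p \<noteq> 0" using Rp e by (auto simp: p_def)
      \<comment> \<open>At the balanced height each of the four radial pieces costs at most a
        multiple of the displacement itself.\<close>
      have NR: "N R = t / b2 R"
      proof -
        have "N R * b2 R = t" using P_eq[of R] Rp P_Pinv[of t] st by (simp add: R_def)
        then show ?thesis using b_pos(2)[OF Rp] by (simp add: field_simps)
      qed
      have "N s \<le> N R" using R st by (simp add: N_mono)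
      then have "B * N (norm x1) \<le> B * N R" "B * N (norm y1) \<le> B * N R"
        using Ns B(1) by (auto intro!: mult_left_mono)
      then have "\<bar>\<psi> y - \<psi> x\<bar> \<le> 4 * (B * N R) + A * (t / b2 R)"
        using rad[of x2 x1] rad[of x2 p] rad[of y2 p] rad[of y2 y1] move2[OF adm p(2), of y2 x2]
        by (simp add: x y t_def p(1))
      also have "\<dots> = (A + 4 * B) * (t / b2 R)" by (simp add: NR algebra_simps)
      also have "\<dots> \<le> K * (t / b2 R)" using K st b_nonneg by (intro mult_right_mono) auto
      also have "\<dots> \<le> K * D_fun \<delta>1 \<delta>1' \<delta>2 \<delta>2' x y" unfolding D R using K lb by (intro mult_left_mono) auto
      finally show ?thesis .
    qed
  qed
  have "riem_dist c1 c2 x y \<le> ereal (K * D_fun \<delta>1 \<delta>1' \<delta>2 \<delta>2' x y)" for x y :: "(real ^ 'n) \<times> (real ^ 'm)"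
  proof -
    \<comment> \<open>Symmetry of D and the absolute value in \<open>bound\<close> remove the
      assumption that |y_1| \<le> |x_1|.\<close>
    have sym: "D_fun \<delta>1 \<delta>1' \<delta>2 \<delta>2' x y = D_fun \<delta>1 \<delta>1' \<delta>2 \<delta>2' y x"
      by (simp add: D_fun_eq norm_minus_commute add.commute)
    have "\<psi> x - \<psi> y \<le> K * D_fun \<delta>1 \<delta>1' \<delta>2 \<delta>2' x y" if "admissible c1 c2 \<psi>" for \<psi>
      using bound[OF that, of x y] bound[OF that, of y x] sym
      by (cases "norm (fst y) \<le> norm (fst x)") (simp_all add: abs_le_iff)
    then show ?thesis unfolding riem_dist_admissible by (intro Sup_least) auto
  qed
  then show ?thesis using K by (intro that[of K]) auto
qed

section \<open>Measurability of the balls\<close>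

text \<open>A supremum of continuous functions is lower semicontinuous.\<close>

lemma closed_riem_dist_le:
  "closed {y :: (real ^ 'n) \<times> (real ^ 'm). riem_dist c1 c2 x y \<le> ereal r}"
proof -
  have "{y. riem_dist c1 c2 x y \<le> ereal r}
      = (\<Inter>\<psi>\<in>{\<psi>. admissible c1 c2 \<psi>}. {y :: (real ^ 'n) \<times> (real ^ 'm). \<psi> x - \<psi> y \<le> r})"
    unfolding riem_dist_admissible by (auto simp: Sup_le_iff)
  moreover have "closed {y :: (real ^ 'n) \<times> (real ^ 'm). \<psi> x - \<psi> y \<le> r}" if "admissible c1 c2 \<psi>" for \<psi>
    using that by (intro closed_Collect_le continuous_intros) (auto simp: admissible_def)
  ultimately show ?thesis by auto
qed

text \<open>The ball is a countable union of closed sublevel sets. Its measurability is needed for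
  the lower volume bound, because \<open>emeasure\<close> gives 0 to a non-measurable set.\<close>

lemma riem_ball_measurable: "riem_ball c1 c2 (x :: (real ^ 'n) \<times> (real ^ 'm)) r \<in> sets lebesgue"
proof -
  have "riem_ball c1 c2 x r = (\<Union>n. {y. riem_dist c1 c2 x y \<le> ereal (r - 1 / Suc n)})"
  proof (rule set_eqI)
    fix y
    have "\<exists>n. d \<le> ereal (r - 1 / Suc n)" if d: "d < ereal r" for d :: ereal
    proof -
      obtain q where q: "d < ereal q" "q < r" using ereal_dense2[OF d] by auto
      obtain n where "1 / Suc n < r - q" using q by (metis diff_gt_0_iff_gt nat_approx_posE)
      then have "ereal q \<le> ereal (r - 1 / Suc n)" by simp
      then show ?thesis using q(1) by (meson less_imp_le order_trans)
    qed
    moreover have "d < ereal r" if "d \<le> ereal (r - 1 / Suc n)" for n and d :: ereal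
      using that by (rule order_le_less_trans) simp
    ultimately show "y \<in> riem_ball c1 c2 x r \<longleftrightarrow> y \<in> (\<Union>n. {y. riem_dist c1 c2 x y \<le> ereal (r - 1 / Suc n)})"
      by (auto simp: riem_ball_def)
  qed
  also have "\<dots> \<in> sets borel" by (intro sets.countable_UN) (auto simp: closed_riem_dist_le)
  finally show ?thesis by (simp add: sets_completionI_sets)
qed

end

section \<open>Volume of balls\<close>

lemma emeasure_cball_Times_cball:
  fixes a :: "'a::euclidean_space" and b :: "'b::euclidean_space"
  assumes "r \<ge> 0" "s \<ge> 0"
  shows "emeasure lebesgue (cball a r \<times> cball b s)
     = ennreal (unit_ball_vol DIM('a) * r ^ DIM('a) * (unit_ball_vol DIM('b) * s ^ DIM('b)))"
proof -
  have "emeasure lebesgue (cball a r \<times> cball b s)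
      = emeasure (lborel \<Otimes>\<^sub>M lborel) (cball a r \<times> cball b s)"
    by (simp add: lborel_prod borel_Times)
  also have "\<dots> = emeasure lborel (cball a r) * emeasure lborel (cball b s)"
    by (rule lborel.emeasure_pair_measure_Times) auto
  finally show ?thesis using assms by (simp add: emeasure_cball flip: ennreal_mult)
qed

lemma comparable_onI:
  assumes "h > 0" "k > 0" "\<And>x. x \<in> A \<Longrightarrow> f x \<le> ereal (h * g x)" "\<And>x. x \<in> A \<Longrightarrow> ereal (g x) \<le> ereal k * f x"
  shows "comparable_on A f (\<lambda>x. ereal (g x))"
  unfolding comparable_on_def
proof (rule exI[of _ "1 / h"], rule exI[of _ k], intro conjI ballI)
  show "ereal (1 / h) * f x \<le> ereal (g x)" if "x \<in> A" for x
  proof -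
    have "ereal (1 / h) * f x \<le> ereal (1 / h) * ereal (h * g x)"
      using assms that by (intro ereal_mult_left_mono) auto
    also have "\<dots> = ereal (g x)" using assms(1) by simp
    finally show ?thesis .
  qed
qed (use assms in auto)

context grusin_exponents
begin

section \<open>Half-widths of the comparison boxes\<close>

definition "rad X r = max X (Ninv r)" for X r :: real
definition "rad1 X r = r * b1 (rad X r)" for X r :: real
definition "rad2 X r = r * b2 (rad X r)" for X r :: real

lemma rad_pos: "r > 0 \<Longrightarrow> rad X r > 0" "r > 0 \<Longrightarrow> rad1 X r > 0" "r > 0 \<Longrightarrow> rad2 X r > 0"
  using Ninv_pos[of r] b_pos[of "rad X r"] by (auto simp: rad_def rad1_def rad2_def less_max_iff_disj)

text \<open>If r \<ge> N X then \<open>rad X r\<close> is \<open>Ninv r\<close>, and the powers of r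
  add up to D; otherwise it is X, and the powers of X add up to \<beta>. So the claimed volume is
  that of the box up to the volumes of unit balls.\<close>

lemma volume_fun_eq:
  fixes x :: "(real ^ 'n) \<times> (real ^ 'm)"
  assumes r: "r > 0"
  shows "volume_fun \<delta>1 \<delta>1' \<delta>2 \<delta>2' x r = rad1 (norm (fst x)) r ^ CARD('n) * rad2 (norm (fst x)) r ^ CARD('m)"
proof -
  define X where "X = norm (fst x)"
  define n m where "n = CARD('n)" and "m = CARD('m)"
  have X: "X \<ge> 0" by (simp add: X_def)
  have V: "volume_fun \<delta>1 \<delta>1' \<delta>2 \<delta>2' x r = (if r \<ge> N X
      then bipow ((real n + real m * (1 + \<delta>2 - \<delta>1)) / (1 - \<delta>1)) ((real n + real m * (1 + \<delta>2' - \<delta>1')) / (1 - \<delta>1')) r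
      else r ^ (n + m) * bipow (real n * \<delta>1 + real m * \<delta>2) (real n * \<delta>1' + real m * \<delta>2') X)"
    by (simp add: volume_fun_def Let_def n_def m_def X_def N_def)
  have exponent: "real n * (1 + 1 / (1 - d) * d) + real m * (1 + 1 / (1 - d) * e)
      = (real n + real m * (1 + e - d)) / (1 - d)" if "d < 1" for d e :: real
  proof -
    have "1 + 1 / (1 - d) * d = 1 / (1 - d)" "1 + 1 / (1 - d) * e = (1 + e - d) / (1 - d)"
      using that by (simp_all add: field_simps)
    then show ?thesis by (simp add: add_divide_distrib)
  qed
  have "volume_fun \<delta>1 \<delta>1' \<delta>2 \<delta>2' x r = rad1 X r ^ n * rad2 X r ^ m"
  proof (cases "r \<ge> N X")
    case True
    then have "X \<le> Ninv r" using N_mono[of X "Ninv r"] N_Ninv[of r] Ninv_nonneg[of r] X r by simp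
    then have R: "rad X r = Ninv r" by (simp add: rad_def max_absorb2)
    have "rad1 X r = bipow 1 1 r * bipow (1 / (1 - \<delta>1) * \<delta>1) (1 / (1 - \<delta>1') * \<delta>1') r"
      "rad2 X r = bipow 1 1 r * bipow (1 / (1 - \<delta>1) * \<delta>2) (1 / (1 - \<delta>1') * \<delta>2') r"
      unfolding rad1_def rad2_def R using r \<delta>
      by (auto simp: bipow_one b1_def b2_def Ninv_def bipow_comp)
    then have "rad1 X r ^ n * rad2 X r ^ m
        = bipow (real n * (1 + 1 / (1 - \<delta>1) * \<delta>1) + real m * (1 + 1 / (1 - \<delta>1) * \<delta>2))
            (real n * (1 + 1 / (1 - \<delta>1') * \<delta>1') + real m * (1 + 1 / (1 - \<delta>1') * \<delta>2')) r"
      using r by (simp only: bipow_mult bipow_power)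
    also have "\<dots> = bipow ((real n + real m * (1 + \<delta>2 - \<delta>1)) / (1 - \<delta>1))
        ((real n + real m * (1 + \<delta>2' - \<delta>1')) / (1 - \<delta>1')) r"
      using exponent[of \<delta>1 \<delta>2] exponent[of \<delta>1' \<delta>2'] \<delta> by (simp only:)
    finally show ?thesis using True V by simp
  next
    case False
    \<comment> \<open>Since \<open>N 0 = 0\<close>, centres with x_1 = 0 always belong to the first
      case.\<close>
    then have "X \<noteq> 0" using r \<delta> by (auto simp: N_def bipow_zero)
    then have X0: "X > 0" using X by simp
    have "Ninv r \<le> X" using False Ninv_le_iff[of X r] X r by simp
    then have R: "rad X r = X" by (simp add: rad_def max_absorb1)
    have "rad1 X r ^ n * rad2 X r ^ m = r ^ (n + m) * (b1 X ^ n * b2 X ^ m)"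
      by (simp add: rad1_def rad2_def R power_mult_distrib power_add)
    also have "b1 X ^ n * b2 X ^ m = bipow (real n * \<delta>1 + real m * \<delta>2) (real n * \<delta>1' + real m * \<delta>2') X"
      using X0 by (simp add: b1_def b2_def bipow_power bipow_mult)
    finally show ?thesis using False V by simp
  qed
  then show ?thesis by (simp add: X_def n_def m_def)
qed

text \<open>Enlarging r by a factor enlarges \<open>Ninv r\<close>, hence the scale, by at most a
  constant factor, and the weights inherit this by scaling. It absorbs the constants of the distance
  comparison when passing to volumes.\<close>

lemma rad_scale:
  assumes "l \<ge> 1"
  obtains C where "C \<ge> 1" "\<And>X r. X \<ge> 0 \<Longrightarrow> r > 0 \<Longrightarrow> rad1 X (l * r) \<le> C * rad1 X r"
    "\<And>X r. X \<ge> 0 \<Longrightarrow> r > 0 \<Longrightarrow> rad2 X (l * r) \<le> C * rad2 X r"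
proof -
  define k where "k = l powr max (1 / (1 - \<delta>1)) (1 / (1 - \<delta>1'))"
  have k: "k \<ge> 1" using assms \<delta> by (simp add: k_def ge_one_powr_ge_zero le_max_iff_disj)
  have le: "rad1 X (l * r) \<le> l * L k * rad1 X r \<and> rad2 X (l * r) \<le> l * L k * rad2 X r"
    if "X \<ge> 0" "r > 0" for X r
  proof -
    have "Ninv (l * r) \<le> k * Ninv r"
      using bipow_scale_upper[OF assms that(2)] by (simp add: Ninv_def k_def)
    also have "\<dots> \<le> k * rad X r" using k by (intro mult_left_mono) (auto simp: rad_def)
    finally have "Ninv (l * r) \<le> k * rad X r" .
    moreover have "X \<le> k * rad X r"
      using mult_mono[of 1 k X "rad X r"] k that by (simp add: rad_def)
    ultimately have "rad X (l * r) \<le> k * rad X r" by (simp add: rad_def)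
    moreover have "0 \<le> rad X (l * r)" using that by (simp add: rad_def le_max_iff_disj)
    ultimately have "b1 (rad X (l * r)) \<le> b1 (k * rad X r)" "b2 (rad X (l * r)) \<le> b2 (k * rad X r)"
      by (simp_all add: b_mono)
    then have "b1 (rad X (l * r)) \<le> L k * b1 (rad X r)" "b2 (rad X (l * r)) \<le> L k * b2 (rad X r)"
      using b_scale[OF k, of "rad X r"] rad_pos(1)[OF that(2), of X] by auto
    then have "l * r * b1 (rad X (l * r)) \<le> l * r * (L k * b1 (rad X r))"
      "l * r * b2 (rad X (l * r)) \<le> l * r * (L k * b2 (rad X r))"
      using assms that by (auto intro!: mult_left_mono)
    then show ?thesis by (simp add: rad1_def rad2_def mult_ac)
  qed
  have "l * L k \<ge> 1" using assms L_ge_1[OF k] mult_mono[of 1 l 1 "L k"] by simp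
  with le show ?thesis by (intro that[of "l * L k"]) auto
qed

section \<open>Comparison of sublevel sets of D with boxes\<close>

text \<open>If Ninv r \<le> X the weights at s are at least those at R = X, and each summand is at
  most r. Otherwise r = N R, and the summands are at most N (3 R) \<le> 3 r and N (Pinv t) \<le> N R
  = r, which gives 4 in total.\<close>

lemma D_fun_le_of_box:
  assumes r: "r > 0" and y: "norm (fst x - fst y) \<le> rad1 (norm (fst x)) r" "norm (snd x - snd y) \<le> rad2 (norm (fst x)) r"
  shows "D_fun \<delta>1 \<delta>1' \<delta>2 \<delta>2' x y \<le> 4 * r"
proof -
  define X where "X = norm (fst x)"
  define s where "s = norm (fst x) + norm (fst y)"
  define l where "l = norm (fst x - fst y)"
  define t where "t = norm (snd x - snd y)"
  define R where "R = rad X r"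
  have D: "D_fun \<delta>1 \<delta>1' \<delta>2 \<delta>2' x y = l / b1 s + t / b2 (max s (Pinv t))"
    by (simp add: D_fun_eq s_def l_def t_def)
  have "Ninv r \<le> R" by (simp add: R_def rad_def)
  moreover have "R > 0" using rad_pos(1)[OF r] by (simp add: R_def)
  ultimately have R: "R > 0" "r \<le> N R" using Ninv_le_iff[of R r] r by auto
  have X: "X \<ge> 0" and Xs: "X \<le> s" by (auto simp: X_def s_def)
  have ls: "l \<le> s" unfolding l_def s_def by (rule norm_triangle_ineq4)
  have lt: "l \<le> r * b1 R" "t \<le> r * b2 R" "t \<ge> 0" "l \<ge> 0"
    using y by (auto simp: rad1_def rad2_def R_def X_def l_def t_def)
  show ?thesis
  proof (cases "Ninv r \<le> X")
    case True
    then have "R = X" by (simp add: R_def rad_def max_absorb1)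
    then have RX: "R \<le> s" "R \<le> max s (Pinv t)" using Xs by auto
    have "l / b1 s \<le> l / b1 R" "t / b2 (max s (Pinv t)) \<le> t / b2 R"
      using b_pos[OF R(1)] b_mono(1)[of R s] b_mono(2)[of R "max s (Pinv t)"] R RX lt
      by (auto intro!: frac_le[OF _ order_refl])
    moreover have "l / b1 R \<le> r" "t / b2 R \<le> r"
      using lt b_pos[OF R(1)] by (auto simp: field_simps)
    ultimately show ?thesis using D r by linarith
  next
    case False
    then have R': "R = Ninv r" "X \<le> R" by (auto simp: R_def rad_def)
    then have r': "r = N R" using N_Ninv r by simp
    have b: "b1 R > 0" "b2 R > 0" using b_pos R by auto
    have "l \<le> R" using lt(1) b R by (simp add: r' N_eq)
    moreover have "norm (fst y) \<le> X + l"
      using norm_triangle_ineq[of "fst x" "fst y - fst x"] by (simp add: X_def l_def norm_minus_commute)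
    ultimately have s3: "s \<le> 3 * R" using R' by (simp add: s_def X_def)
    \<comment> \<open>Here s may be far below R, so \<open>b1 s\<close> has no useful lower bound; l
      \<le> s turns the quotient into the monotone function N.\<close>
    have "l / b1 s \<le> s / b1 s" using ls b_nonneg by (intro divide_right_mono) auto
    also have "\<dots> = N s" using Xs X by (simp add: N_eq)
    also have "\<dots> \<le> N (3 * R)" using s3 Xs X R by (simp add: N_mono)
    also have "\<dots> = 3 * R / b1 (3 * R)" using R by (simp add: N_eq)
    also have "\<dots> \<le> 3 * R / b1 R"
      using R b b_pos[of "3 * R"] by (intro divide_left_mono b_mono mult_pos_pos) auto
    also have "\<dots> = 3 * r" using R by (simp add: r' N_eq)
    finally have 1: "l / b1 s \<le> 3 * r" .
    have "t / b2 (max s (Pinv t)) \<le> r"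
    proof (cases "t = 0")
      case False
      then have t: "t > 0" using lt by simp
      define Q where "Q = Pinv t"
      have Q: "Q > 0" "P Q = t" using Pinv_pos[OF t] P_Pinv[of t] t by (auto simp: Q_def)
      have "t \<le> P R" using lt(2) R by (simp add: r' P_eq)
      then have QR: "Q \<le> R" using Pinv_le_iff[of R t] R t by (simp add: Q_def)
      have "t / b2 (max s Q) \<le> t / b2 Q"
        using t Q b_pos by (intro divide_left_mono b_mono mult_pos_pos) (auto simp: less_max_iff_disj)
      also have "\<dots> = N Q" using Q b_pos(2)[OF Q(1)] P_eq[of Q] by (simp add: field_simps)
      also have "\<dots> \<le> N R" using QR Q by (simp add: N_mono)
      finally show ?thesis by (simp add: Q_def r')
    qed (use r in simp)
    then show ?thesis using 1 D by linarith
  qed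
qed

text \<open>Everything follows from s \<le> k R. If |y_1| \<le> 2 X this is clear. Otherwise s \<le>
  3 l, so N s \<le> 3 r \<le> 3 N R, and N has growth exponent at least \<mu> > 0.\<close>

lemma box_of_D_fun_less:
  obtains C where "C \<ge> 1"
    "\<And>(x :: (real ^ 'n) \<times> (real ^ 'm)) y r. D_fun \<delta>1 \<delta>1' \<delta>2 \<delta>2' x y < r \<Longrightarrow> r > 0 \<Longrightarrow>
       norm (fst x - fst y) \<le> C * rad1 (norm (fst x)) r \<and> norm (snd x - snd y) \<le> C * rad2 (norm (fst x)) r"
proof -
  define \<mu> where "\<mu> = min (1 - \<delta>1) (1 - \<delta>1')"
  have \<mu>: "\<mu> > 0" using \<delta> by (simp add: \<mu>_def)
  \<comment> \<open>The value 3 serves the case |y_1| \<le> 2 X; 3^(1/\<mu>) makes k^\<mu> \<ge> 3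
    in the other case.\<close>
  define k where "k = max 3 (3 powr (1 / \<mu>))"
  have k: "k \<ge> 1" "k \<ge> 3" by (auto simp: k_def)
  have k3: "3 \<le> k powr \<mu>"
  proof -
    have "3 = (3 powr (1 / \<mu>)) powr \<mu>" using \<mu> by (simp add: powr_powr)
    also have "\<dots> \<le> k powr \<mu>" using \<mu> by (intro powr_mono2) (auto simp: k_def)
    finally show ?thesis .
  qed
  have "norm (fst x - fst y) \<le> L k * rad1 (norm (fst x)) r \<and> norm (snd x - snd y) \<le> L k * rad2 (norm (fst x)) r"
    if less: "D_fun \<delta>1 \<delta>1' \<delta>2 \<delta>2' x y < r" and r: "r > 0" for x y :: "(real ^ 'n) \<times> (real ^ 'm)" and r
  proof -
    define X where "X = norm (fst x)"
    define s where "s = norm (fst x) + norm (fst y)"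
    define l where "l = norm (fst x - fst y)"
    define t where "t = norm (snd x - snd y)"
    define R where "R = rad X r"
    have D: "D_fun \<delta>1 \<delta>1' \<delta>2 \<delta>2' x y = l / b1 s + t / b2 (max s (Pinv t))"
      by (simp add: D_fun_eq s_def l_def t_def)
    have st: "s \<ge> 0" "l \<ge> 0" "t \<ge> 0" by (auto simp: s_def l_def t_def)
    then have "l / b1 s \<ge> 0" "t / b2 (max s (Pinv t)) \<ge> 0" using b_nonneg by auto
    then have l_less: "l / b1 s < r" and t_less: "t / b2 (max s (Pinv t)) < r" using D less by linarith+
    have "Ninv r \<le> R" by (simp add: R_def rad_def)
  moreover have "R > 0" using rad_pos(1)[OF r] by (simp add: R_def)
  ultimately have R: "R > 0" "r \<le> N R" using Ninv_le_iff[of R r] r by auto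
    have XR: "X \<le> R" and NR: "Ninv r \<le> R" by (auto simp: R_def rad_def)
    have ls: "l \<le> s" unfolding l_def s_def by (rule norm_triangle_ineq4)
    have sR: "s \<le> k * R"
    proof (cases "norm (fst y) \<le> 2 * X")
      case True
      then have "s \<le> 3 * R" using XR by (simp add: s_def X_def)
      also have "\<dots> \<le> k * R" using k R by (intro mult_right_mono) auto
      finally show ?thesis .
    next
      case False
      have "norm (fst y) \<le> X + l"
        using norm_triangle_ineq[of "fst x" "fst y - fst x"] by (simp add: X_def l_def norm_minus_commute)
      then have sl: "s \<le> 3 * l" using False by (simp add: s_def X_def)
      have "N s = s / b1 s" using st by (simp add: N_eq)
      also have "\<dots> \<le> 3 * l / b1 s" using sl b_nonneg by (intro divide_right_mono) auto
      also have "\<dots> \<le> 3 * r" using l_less by simp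
      also have "\<dots> \<le> k powr \<mu> * N R" using k3 R r by (intro mult_mono) auto
      also have "\<dots> \<le> N (k * R)" using bipow_scale_lower[OF k(1) R(1)] by (simp add: \<mu>_def N_def)
      finally show ?thesis using st R k by (simp add: N_mono)
    qed
    then have "b1 s \<le> b1 (k * R)" "b2 s \<le> b2 (k * R)" using st by (auto intro: b_mono)
    then have bs: "b1 s \<le> L k * b1 R" "b2 s \<le> L k * b2 R"
      using b_scale[OF k(1), of R] R by auto
    have Lb: "b2 R \<le> L k * b2 R" using L_ge_1[OF k(1)] b_nonneg[of R] mult_right_mono[of 1 "L k" "b2 R"] by simp
    have "l \<le> r * b1 s"
    proof (cases "s = 0")
      case False
      then show ?thesis using l_less st b_pos[of s] by (simp add: field_simps)
    qed (use ls st b_nonneg[of s] r in simp)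
    also have "\<dots> \<le> r * (L k * b1 R)" using bs r by simp
    finally have 1: "l \<le> L k * rad1 X r" by (simp add: rad1_def R_def mult_ac)
    have "t \<le> r * (L k * b2 R)"
    proof (cases "t = 0")
      case False
      then have t: "t > 0" using st by simp
      define Q where "Q = Pinv t"
      have Q: "Q > 0" "P Q = t" using Pinv_pos[OF t] P_Pinv[of t] t by (auto simp: Q_def)
      show ?thesis
      proof (cases "Q \<le> s")
        case True
        then have "t / b2 s < r" using t_less by (simp add: Q_def max_absorb1)
        moreover have "b2 s > 0" using True Q b_pos by simp
        ultimately have "t \<le> r * b2 s" by (simp add: field_simps)
        also have "\<dots> \<le> r * (L k * b2 R)" using bs r by simp
        finally show ?thesis .
      next
        case False
        \<comment> \<open>In this regime t / b2 Q equals N Q, so the smallness of the summand bounds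
          the height Q by \<open>Ninv r\<close>, hence by R.\<close>
        then have tQ: "t / b2 Q < r" using t_less by (simp add: Q_def max_def)
        moreover have "t / b2 Q = N Q" using Q b_pos(2)[OF Q(1)] P_eq[of Q] by (simp add: field_simps)
        ultimately have "N Q \<le> N (Ninv r)" using N_Ninv r by simp
        then have "Q \<le> R" using N_mono[of Q "Ninv r"] Q Ninv_nonneg NR by (simp add: order_trans)
        then have "b2 Q \<le> L k * b2 R" using b_mono(2)[of Q R] Q Lb by simp
        moreover have "t \<le> r * b2 Q" using tQ b_pos(2)[OF Q(1)] by (simp add: field_simps)
        ultimately show ?thesis using r by (meson mult_le_cancel_left_pos order_trans)
      qed
    next
      case True
      then show ?thesis using r b_nonneg L_ge_1[OF k(1)] by simp
    qed
    then have "t \<le> L k * rad2 X r" by (simp add: rad2_def R_def mult_ac)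
    with 1 show ?thesis by (simp add: X_def l_def t_def)
  qed
  then show ?thesis using L_ge_1[OF k(1)] by (intro that[of "L k"]) auto
qed

end

context grusin
begin

text \<open>The ball lies between two boxes with the same centre whose half-widths are constant
  multiples of \<open>rad1\<close> and \<open>rad2\<close>; the volume function is exactly the
  product of the corresponding powers.\<close>

lemma riem_ball_volume:
  "comparable_on (UNIV \<times> {0<..})
     (\<lambda>(x :: (real ^ 'n) \<times> (real ^ 'm), r). enn2ereal (emeasure lebesgue (riem_ball c1 c2 x r)))
     (\<lambda>(x, r). ereal (volume_fun \<delta>1 \<delta>1' \<delta>2 \<delta>2' x r))"
proof -
  obtain K1 where K1: "K1 > 0"
    "\<And>x y :: (real ^ 'n) \<times> (real ^ 'm). ereal (D_fun \<delta>1 \<delta>1' \<delta>2 \<delta>2' x y) \<le> ereal K1 * riem_dist c1 c2 x y"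
    by (rule D_fun_le_riem_dist) blast
  obtain K2 where K2: "K2 > 0"
    "\<And>x y :: (real ^ 'n) \<times> (real ^ 'm). riem_dist c1 c2 x y \<le> ereal (K2 * D_fun \<delta>1 \<delta>1' \<delta>2 \<delta>2' x y)"
    by (rule riem_dist_le_D_fun) blast
  define \<omega> where "\<omega> = unit_ball_vol CARD('n) * unit_ball_vol CARD('m)"
  have \<omega>: "\<omega> > 0" by (simp add: \<omega>_def)
  have box: "emeasure lebesgue (cball (fst x) (k * r1) \<times> cball (snd x) (k * r2))
      = ennreal (\<omega> * k ^ (CARD('n) + CARD('m)) * (r1 ^ CARD('n) * r2 ^ CARD('m)))"
    if "k \<ge> 0" "r1 \<ge> 0" "r2 \<ge> 0" for x :: "(real ^ 'n) \<times> (real ^ 'm)" and k r1 r2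
    using that by (subst emeasure_cball_Times_cball) (auto simp: \<omega>_def power_mult_distrib power_add mult_ac)

  obtain C where C: "C \<ge> 1"
    "\<And>(x :: (real ^ 'n) \<times> (real ^ 'm)) y r. D_fun \<delta>1 \<delta>1' \<delta>2 \<delta>2' x y < r \<Longrightarrow> r > 0 \<Longrightarrow>
       norm (fst x - fst y) \<le> C * rad1 (norm (fst x)) r \<and> norm (snd x - snd y) \<le> C * rad2 (norm (fst x)) r"
    by (rule box_of_D_fun_less) blast
  \<comment> \<open>The maximum with 1 is taken because \<open>rad_scale\<close> concerns factors at
    least 1.\<close>
  define l where "l = max 1 K1"
  obtain M where M: "M \<ge> 1" "\<And>X r. X \<ge> 0 \<Longrightarrow> r > 0 \<Longrightarrow> rad1 X (l * r) \<le> M * rad1 X r"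
    "\<And>X r. X \<ge> 0 \<Longrightarrow> r > 0 \<Longrightarrow> rad2 X (l * r) \<le> M * rad2 X r"
    by (rule rad_scale[of l]) (auto simp: l_def)
  have upper: "emeasure lebesgue (riem_ball c1 c2 x r)
      \<le> ennreal (\<omega> * (C * M) ^ (CARD('n) + CARD('m)) * volume_fun \<delta>1 \<delta>1' \<delta>2 \<delta>2' x r)"
    if r: "r > 0" for x :: "(real ^ 'n) \<times> (real ^ 'm)" and r
  proof -
    let ?X = "norm (fst x)"
    have "riem_ball c1 c2 x r \<subseteq> cball (fst x) (C * M * rad1 ?X r) \<times> cball (snd x) (C * M * rad2 ?X r)"
    proof
      fix y assume "y \<in> riem_ball c1 c2 x r"
      then have "riem_dist c1 c2 x y < ereal r" by (simp add: riem_ball_def)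
      then have "ereal K1 * riem_dist c1 c2 x y < ereal K1 * ereal r"
        using K1(1) by (intro ereal_mult_strict_left_mono) auto
      then have "ereal (D_fun \<delta>1 \<delta>1' \<delta>2 \<delta>2' x y) < ereal (K1 * r)"
        using order_le_less_trans[OF K1(2)[of x y], of "ereal (K1 * r)"] by simp
      moreover have "K1 * r \<le> l * r" using r by (intro mult_right_mono) (auto simp: l_def)
      ultimately have "D_fun \<delta>1 \<delta>1' \<delta>2 \<delta>2' x y < l * r" by simp
      moreover have "l * r > 0" using r by (simp add: l_def)
      ultimately have "norm (fst x - fst y) \<le> C * rad1 ?X (l * r)" "norm (snd x - snd y) \<le> C * rad2 ?X (l * r)"
        using C(2) by blast+
      moreover have "C * rad1 ?X (l * r) \<le> C * (M * rad1 ?X r)" "C * rad2 ?X (l * r) \<le> C * (M * rad2 ?X r)"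
        using C(1) M(2,3)[of ?X r] r by (auto intro!: mult_left_mono)
      ultimately show "y \<in> cball (fst x) (C * M * rad1 ?X r) \<times> cball (snd x) (C * M * rad2 ?X r)"
        by (auto simp: mem_Times_iff dist_norm mult_ac)
    qed
    then have "emeasure lebesgue (riem_ball c1 c2 x r)
        \<le> emeasure lebesgue (cball (fst x) (C * M * rad1 ?X r) \<times> cball (snd x) (C * M * rad2 ?X r))"
      by (rule emeasure_mono) (auto intro!: sets_completionI_sets simp: borel_Times)
    also have "\<dots> = ennreal (\<omega> * (C * M) ^ (CARD('n) + CARD('m)) * volume_fun \<delta>1 \<delta>1' \<delta>2 \<delta>2' x r)"
      using rad_pos[OF r, of ?X] C(1) M(1) by (subst box) (auto simp: volume_fun_eq[OF r])
    finally show ?thesis .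
  qed

  \<comment> \<open>The box for r/\<mu> has D \<le> 4 r/\<mu>, so distances in it are at most 4 K2
    r/\<mu>, which is strictly less than r; the summand 1 ensures \<mu> \<ge> 1 for
    \<open>rad_scale\<close>.\<close>
  define \<mu> where "\<mu> = 8 * K2 + 1"
  have \<mu>: "\<mu> \<ge> 1" using K2 by (simp add: \<mu>_def)
  obtain M' where M': "M' \<ge> 1" "\<And>X r. X \<ge> 0 \<Longrightarrow> r > 0 \<Longrightarrow> rad1 X (\<mu> * r) \<le> M' * rad1 X r"
    "\<And>X r. X \<ge> 0 \<Longrightarrow> r > 0 \<Longrightarrow> rad2 X (\<mu> * r) \<le> M' * rad2 X r"
    by (rule rad_scale[OF \<mu>]) blast
  have lower: "ennreal (\<omega> * (1 / M') ^ (CARD('n) + CARD('m)) * volume_fun \<delta>1 \<delta>1' \<delta>2 \<delta>2' x r)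
      \<le> emeasure lebesgue (riem_ball c1 c2 x r)"
    if r: "r > 0" for x :: "(real ^ 'n) \<times> (real ^ 'm)" and r
  proof -
    let ?X = "norm (fst x)"
    have r': "r / \<mu> > 0" using r \<mu> by simp
    have "rad1 ?X r \<le> M' * rad1 ?X (r / \<mu>)" "rad2 ?X r \<le> M' * rad2 ?X (r / \<mu>)"
      using M'(2,3)[of ?X "r / \<mu>"] r' \<mu> by auto
    then have le: "1 / M' * rad1 ?X r \<le> rad1 ?X (r / \<mu>)" "1 / M' * rad2 ?X r \<le> rad2 ?X (r / \<mu>)"
      using M'(1) by (auto simp: field_simps)
    have "cball (fst x) (1 / M' * rad1 ?X r) \<times> cball (snd x) (1 / M' * rad2 ?X r) \<subseteq> riem_ball c1 c2 x r"
    proof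
      fix y assume "y \<in> cball (fst x) (1 / M' * rad1 ?X r) \<times> cball (snd x) (1 / M' * rad2 ?X r)"
      then have "norm (fst x - fst y) \<le> rad1 ?X (r / \<mu>)" "norm (snd x - snd y) \<le> rad2 ?X (r / \<mu>)"
        using le by (auto simp: mem_Times_iff dist_norm)
      then have "D_fun \<delta>1 \<delta>1' \<delta>2 \<delta>2' x y \<le> 4 * (r / \<mu>)" by (rule D_fun_le_of_box[OF r'])
      then have "K2 * D_fun \<delta>1 \<delta>1' \<delta>2 \<delta>2' x y \<le> K2 * (4 * (r / \<mu>))"
        using K2(1) by (intro mult_left_mono) auto
      also have "\<dots> < r" using K2(1) r by (auto simp: \<mu>_def field_simps intro!: add_pos_pos)
      finally have "K2 * D_fun \<delta>1 \<delta>1' \<delta>2 \<delta>2' x y < r" .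
      then show "y \<in> riem_ball c1 c2 x r"
        using order_le_less_trans[OF K2(2)[of x y], of "ereal r"] by (simp add: riem_ball_def)
    qed
    then have "emeasure lebesgue (cball (fst x) (1 / M' * rad1 ?X r) \<times> cball (snd x) (1 / M' * rad2 ?X r))
        \<le> emeasure lebesgue (riem_ball c1 c2 x r)"
      by (rule emeasure_mono) (rule riem_ball_measurable)
    moreover have "emeasure lebesgue (cball (fst x) (1 / M' * rad1 ?X r) \<times> cball (snd x) (1 / M' * rad2 ?X r))
        = ennreal (\<omega> * (1 / M') ^ (CARD('n) + CARD('m)) * volume_fun \<delta>1 \<delta>1' \<delta>2 \<delta>2' x r)"
      using rad_pos[OF r, of ?X] M'(1) by (subst box) (auto simp: volume_fun_eq[OF r])
    ultimately show ?thesis by simp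
  qed

  define h where "h = \<omega> * (C * M) ^ (CARD('n) + CARD('m))"
  define k where "k = \<omega> * (1 / M') ^ (CARD('n) + CARD('m))"
  have hk: "h > 0" "k > 0" using \<omega> C(1) M(1) M'(1) by (auto simp: h_def k_def)
  have V: "volume_fun \<delta>1 \<delta>1' \<delta>2 \<delta>2' x r > 0" if "r > 0" for x :: "(real ^ 'n) \<times> (real ^ 'm)" and r
    using rad_pos[OF that] by (simp add: volume_fun_eq[OF that])
  have "comparable_on (UNIV \<times> {0<..})
     (\<lambda>(x :: (real ^ 'n) \<times> (real ^ 'm), r). enn2ereal (emeasure lebesgue (riem_ball c1 c2 x r)))
     (\<lambda>z. ereal (case z of (x, r) \<Rightarrow> volume_fun \<delta>1 \<delta>1' \<delta>2 \<delta>2' x r))"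
  proof (rule comparable_onI[where h = h and k = "1 / k"])
    fix z :: "((real ^ 'n) \<times> (real ^ 'm)) \<times> real" assume "z \<in> UNIV \<times> {0<..}"
    then obtain x r where z: "z = (x, r)" "r > 0" by auto
    have "enn2ereal (emeasure lebesgue (riem_ball c1 c2 x r)) \<le> enn2ereal (ennreal (h * volume_fun \<delta>1 \<delta>1' \<delta>2 \<delta>2' x r))"
      using upper[OF z(2)] by (simp add: h_def less_eq_ennreal.rep_eq)
    then show "(case z of (x, r) \<Rightarrow> enn2ereal (emeasure lebesgue (riem_ball c1 c2 x r)))
        \<le> ereal (h * (case z of (x, r) \<Rightarrow> volume_fun \<delta>1 \<delta>1' \<delta>2 \<delta>2' x r))"
      using hk V[OF z(2)] z(1) by (simp add: enn2ereal_ennreal less_imp_le)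
    have "enn2ereal (ennreal (k * volume_fun \<delta>1 \<delta>1' \<delta>2 \<delta>2' x r)) \<le> enn2ereal (emeasure lebesgue (riem_ball c1 c2 x r))"
      using lower[OF z(2)] by (simp add: k_def less_eq_ennreal.rep_eq)
    then have "ereal (k * volume_fun \<delta>1 \<delta>1' \<delta>2 \<delta>2' x r) \<le> enn2ereal (emeasure lebesgue (riem_ball c1 c2 x r))"
      using hk V[OF z(2)] by (simp add: enn2ereal_ennreal less_imp_le)
    then have "ereal (1 / k) * ereal (k * volume_fun \<delta>1 \<delta>1' \<delta>2 \<delta>2' x r)
        \<le> ereal (1 / k) * enn2ereal (emeasure lebesgue (riem_ball c1 c2 x r))"
      using hk by (intro ereal_mult_left_mono) auto
    then show "ereal (case z of (x, r) \<Rightarrow> volume_fun \<delta>1 \<delta>1' \<delta>2 \<delta>2' x r)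
        \<le> ereal (1 / k) * (case z of (x, r) \<Rightarrow> enn2ereal (emeasure lebesgue (riem_ball c1 c2 x r)))"
      using hk z(1) by simp
  qed (use hk in auto)
  then show ?thesis by (simp add: case_prod_unfold)
qed

lemma riem_dist_comparable:
  "comparable_on UNIV (\<lambda>(x :: (real ^ 'n) \<times> (real ^ 'm), y). riem_dist c1 c2 x y)
     (\<lambda>(x, y). ereal (D_fun \<delta>1 \<delta>1' \<delta>2 \<delta>2' x y))"
proof -
  obtain K1 where K1: "K1 > 0"
    "\<And>x y :: (real ^ 'n) \<times> (real ^ 'm). ereal (D_fun \<delta>1 \<delta>1' \<delta>2 \<delta>2' x y) \<le> ereal K1 * riem_dist c1 c2 x y"
    by (rule D_fun_le_riem_dist) blast
  obtain K2 where K2: "K2 > 0"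
    "\<And>x y :: (real ^ 'n) \<times> (real ^ 'm). riem_dist c1 c2 x y \<le> ereal (K2 * D_fun \<delta>1 \<delta>1' \<delta>2 \<delta>2' x y)"
    by (rule riem_dist_le_D_fun) blast
  show ?thesis unfolding case_prod_unfold
    by (rule comparable_onI[OF K2(1) K1(1) K2(2) K1(2)])
qed

end

theorem proposition5p1:
  fixes c1 c2 :: "real ^ 'n \<Rightarrow> real"
    and \<delta>1 \<delta>1' \<delta>2 \<delta>2' :: real
  assumes "0 \<le> \<delta>1" "\<delta>1 < 1" "0 \<le> \<delta>1'" "\<delta>1' < 1" "0 \<le> \<delta>2" "0 \<le> \<delta>2'"
    and "grusin_coeff \<delta>1 \<delta>1' c1" and "grusin_coeff \<delta>2 \<delta>2' c2"
  shows "comparable_on UNIV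
           (\<lambda>(x :: (real ^ 'n) \<times> (real ^ 'm), y). riem_dist c1 c2 x y)
           (\<lambda>(x, y). ereal (D_fun \<delta>1 \<delta>1' \<delta>2 \<delta>2' x y)) \<and>
         comparable_on (UNIV \<times> {0<..})
           (\<lambda>(x :: (real ^ 'n) \<times> (real ^ 'm), r). enn2ereal (emeasure lebesgue (riem_ball c1 c2 x r)))
           (\<lambda>(x, r). ereal (volume_fun \<delta>1 \<delta>1' \<delta>2 \<delta>2' x r))"
proof -
  interpret grusin \<delta>1 \<delta>1' \<delta>2 \<delta>2' c1 c2
    using assms by unfold_locales
  show ?thesis using riem_dist_comparable riem_ball_volume by blast
qed

end
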